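(* Let $K=\mathbb{F}_2$ and let $S$ be a smooth cubic surface over $K$. Suppose $S$ contains a line $\ell$ defined over $K$ that contains no $K$-rational Eckardt points. Then there exists a point $P\in\ell(K)$ such that $\mathrm{Span}(P)=S(K)$.
   Context: A smooth cubic surface $S$ over $K$ is a nonsingular surface in $\mathbb{P}^3$ defined by a homogeneous cubic polynomial over $K$. A $K$-line is a line in $\mathbb{P}^3$ defined over $K$. A line "on $S$" means a line over $\overline{K}$ contained in $S$. An Eckardt point is a point of $S$ through which three of the lines on $S$ pass. For a line $\ell\not\subset S$, $\ell\cdot S=P+Q+R$ with multiplicity. For $B\subseteq S(K)$ define $B_0=B$ and $B_{n+1}$ as the set of $R\in S(K)$ such that either $R\in B_n$ or there exist $P,Q\in B_n$ and a $K$-line $\ell\not\subset S$ with $\ell\cdot S=P+Q+R$; $\mathrm{Span}(B)=\bigcup_n B_n$, and $\mathrm{Span}(P)=\mathrm{Span}(\{P\})$. *)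

theory Defs
  imports "HOL-Analysis.Finite_Cartesian_Product" "HOL-Library.Z2"
          "HOL-Algebra.Algebraic_Closure_Type"
begin

text \<open>The ground field K = F_2 is the type bit (HOL-Library.Z2); its algebraic
 closure is bit alg_closure, with embedding to_ac.  Homogeneous coordinates on
 P^3 are vectors in 'f^4.  Over F_2 the only nonzero scalar is 1, so a point of
 P^3(F_2) is the same as a nonzero vector of bit^4.\<close>

type_synonym K = bit
type_synonym Kbar = "bit alg_closure"

definition degmons :: "nat \<Rightarrow> (nat^4) set" where
  "degmons d = {e. (\<Sum>i\<in>UNIV. e $ i) = d}"

definition form_eval :: "nat \<Rightarrow> (nat^4 \<Rightarrow> 'a::comm_ring_1) \<Rightarrow> 'a^4 \<Rightarrow> 'a" where
  "form_eval d c x = (\<Sum>e\<in>degmons d. c e * (\<Prod>i\<in>UNIV. (x $ i) ^ (e $ i)))"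

definition dcoef :: "(nat^4 \<Rightarrow> 'a::comm_ring_1) \<Rightarrow> 4 \<Rightarrow> nat^4 \<Rightarrow> 'a" where
  "dcoef c i e = of_nat (e $ i + 1) * c (\<chi> j. if j = i then e $ j + 1 else e $ j)"

definition cubic_bar :: "(nat^4 \<Rightarrow> K) \<Rightarrow> Kbar^4 \<Rightarrow> Kbar" where
  "cubic_bar c x = form_eval 3 (to_ac \<circ> c) x"

definition vec_bar :: "K^4 \<Rightarrow> Kbar^4" where
  "vec_bar v = (\<chi> i. to_ac (v $ i))"

definition smooth_cubic :: "(nat^4 \<Rightarrow> K) \<Rightarrow> bool" where
  "smooth_cubic c \<longleftrightarrow> (\<exists>e\<in>degmons 3. c e \<noteq> 0) \<and>
     (\<forall>x::Kbar^4. x \<noteq> 0 \<longrightarrow> cubic_bar c x = 0 \<longrightarrow>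
        (\<exists>i. form_eval 2 (dcoef (to_ac \<circ> c) i) x \<noteq> 0))"

definition rat_points :: "(nat^4 \<Rightarrow> K) \<Rightarrow> (K^4) set" where
  "rat_points c = {v. v \<noteq> 0 \<and> form_eval 3 c v = 0}"

definition indep2 :: "'a::field^4 \<Rightarrow> 'a^4 \<Rightarrow> bool" where
  "indep2 a b \<longleftrightarrow> (\<forall>s t. s *s a + t *s b = 0 \<longrightarrow> s = 0 \<and> t = 0)"

definition lspan :: "'a::field^4 \<Rightarrow> 'a^4 \<Rightarrow> ('a^4) set" where
  "lspan a b = {s *s a + t *s b | s t. True}"

definition line_on :: "(nat^4 \<Rightarrow> K) \<Rightarrow> Kbar^4 \<Rightarrow> Kbar^4 \<Rightarrow> bool" where
  "line_on c a b \<longleftrightarrow> indep2 a b \<and> (\<forall>x\<in>lspan a b. cubic_bar c x = 0)"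

definition eckardt :: "(nat^4 \<Rightarrow> K) \<Rightarrow> Kbar^4 \<Rightarrow> bool" where
  "eckardt c x \<longleftrightarrow> x \<noteq> 0 \<and> cubic_bar c x = 0 \<and>
     (\<exists>a1 b1 a2 b2 a3 b3. line_on c a1 b1 \<and> line_on c a2 b2 \<and> line_on c a3 b3 \<and>
        x \<in> lspan a1 b1 \<and> x \<in> lspan a2 b2 \<and> x \<in> lspan a3 b3 \<and>
        lspan a1 b1 \<noteq> lspan a2 b2 \<and> lspan a1 b1 \<noteq> lspan a3 b3 \<and>
        lspan a2 b2 \<noteq> lspan a3 b3)"

text \<open>A K-line is spanned by two K-independent K-vectors a b.  For such a line
 not contained in S, the intersection divisor is P+Q+R iff the binary cubic
 F(s a + t b) is a nonzero constant times the product of the linear forms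
 vanishing at the parameters of P, Q, R (identity over Kbar, which is infinite,
 hence an identity of binary forms).\<close>
definition meets3 :: "(nat^4 \<Rightarrow> K) \<Rightarrow> K^4 \<Rightarrow> K^4 \<Rightarrow> K^4 \<Rightarrow> K^4 \<Rightarrow> K^4 \<Rightarrow> bool" where
  "meets3 c a b P Q R \<longleftrightarrow> indep2 a b \<and>
     \<not> (\<forall>s t. cubic_bar c (s *s vec_bar a + t *s vec_bar b) = 0) \<and>
     (\<exists>p1 p2 q1 q2 r1 r2 (\<kappa>::K).
        P = p1 *s a + p2 *s b \<and> Q = q1 *s a + q2 *s b \<and> R = r1 *s a + r2 *s b \<and>
        P \<noteq> 0 \<and> Q \<noteq> 0 \<and> R \<noteq> 0 \<and> \<kappa> \<noteq> 0 \<and>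
        (\<forall>s t :: Kbar. cubic_bar c (s *s vec_bar a + t *s vec_bar b) =
            to_ac \<kappa> * (to_ac p2 * s - to_ac p1 * t) * (to_ac q2 * s - to_ac q1 * t)
                     * (to_ac r2 * s - to_ac r1 * t)))"

definition span_step :: "(nat^4 \<Rightarrow> K) \<Rightarrow> (K^4) set \<Rightarrow> (K^4) set" where
  "span_step c B = {R \<in> rat_points c. R \<in> B \<or>
      (\<exists>P\<in>B. \<exists>Q\<in>B. \<exists>a b. meets3 c a b P Q R)}"

definition Span :: "(nat^4 \<Rightarrow> K) \<Rightarrow> (K^4) set \<Rightarrow> (K^4) set" where
  "Span c B = (\<Union>n. (span_step c ^^ n) B)"

end

theory Submission
  imports Defs "HOL-Analysis.Cartesian_Space"
begin

text \<open>
  Write $D_u$ for the differential of the cubic form $F$ at $u$. On a line that is not contained in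
  the surface, a point $u$ generates $v$ when $v$ lies in the tangent plane at $u$ and the third point
  of the line is off the surface, and $u, v$ generate $u + v$ when that point is on the surface and
  $D_u(v) \neq 0$; these two rules suffice.

  The planes through the given line correspond to the nonzero elements of a two-dimensional space,
  on which each of the three rational points $u$ of the line induces the functional $D_u$. Smoothness
  makes these functionals nonzero and not all equal. If they are distinct, each point is tangent to a
  conic with two further rational points, whose join meets the line in a different point; a suitable
  start reaches all three points and hence all conics. If two of them agree, say at $r$ and $s$, the
  residual conic in one plane is tangent at $r + s$, the one in the second plane passes through $r$ and
  $s$, and the one in the third plane has no rational point on the line; the second conic is either
  smooth, in which case a point $r$ or $s$ spans, or a pair of lines, in which case $r + s$ spans.

  Over the algebraic closure only three facts are needed: the functionals are not all equal (otherwise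
  $a + \omega b$ with $\omega^2 + \omega + 1 = 0$ is singular), a conic singular at a point of the line splits into
  two lines making it an Eckardt point, and a double line would contain a singular point.
\<close>

no_notation fps_nth (infixl \<open>$\<close> 75)

section \<open>Points generated from a line over the field with two elements\<close>

text \<open>\<open>F v\<close> says that the form does not vanish at \<open>v\<close>, and \<open>D u v\<close> that \<open>v\<close> is off the tangent plane at \<open>u\<close>;
  inequality of truth values is addition modulo 2.\<close>

locale binary_cubic =
  fixes F :: "'v::ab_group_add \<Rightarrow> bool" and D :: "'v \<Rightarrow> 'v \<Rightarrow> bool"
  assumes add_self: "x + x = (0::'v)"
    and D_add: "D u (v + w) \<longleftrightarrow> (D u v \<noteq> D u w)"
    and F_add: "F (u + v) \<longleftrightarrow> (F u \<noteq> (F v \<noteq> (D u v \<noteq> D v u)))"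
    and D_self: "D u u \<longleftrightarrow> F u"
begin

lemma add_self_left: "x + (x + y) = (y::'v)"
  by (metis add_self add.assoc add_0)

lemmas char2_simps = add_self add_self_left add.assoc add.commute add.left_commute

lemma add_eq_0_iff: "x + y = 0 \<longleftrightarrow> x = (y::'v)"
  by (metis add_self add_left_cancel)

lemma D_0: "\<not> D u 0"
  using D_add[of u 0 0] by simp

lemma F_0: "\<not> F 0"
  using D_self[of 0] D_0[of 0] by simp

lemma D_0_left: "\<not> D 0 v"
  using F_add[of 0 v] F_0 D_0[of v] by auto

text \<open>For points of the surface the two rules are the divisors u + u + v and u + v + (u + v):
  by \<open>F_add\<close> each forces \<open>D v u\<close>, so on the join with parameters x, y the
  form is x y^2 or x y (x + y).\<close>

definition stable :: "'v set \<Rightarrow> bool" where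
  "stable A \<longleftrightarrow>
     (\<forall>u\<in>A. \<forall>v. \<not> F v \<longrightarrow> \<not> D u v \<longrightarrow> F (u + v) \<longrightarrow> v \<in> A) \<and>
     (\<forall>u\<in>A. \<forall>v\<in>A. D u v \<longrightarrow> \<not> F (u + v) \<longrightarrow> u + v \<in> A)"

text \<open>Quantifying over all stable sets keeps the stages of the actual span out of the
  combinatorics; \<open>Span_stable\<close> makes the connection.\<close>

definition spans :: "'v \<Rightarrow> 'v \<Rightarrow> bool" where
  "spans u v \<longleftrightarrow> (\<forall>A. stable A \<longrightarrow> u \<in> A \<longrightarrow> v \<in> A)"

lemma stable_tangent:
  assumes "stable A" "u \<in> A" "\<not> F v" "\<not> D u v" "F (u + v)"
  shows "v \<in> A"
  using assms unfolding stable_def by blast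

lemma stable_secant:
  assumes "stable A" "u \<in> A" "v \<in> A" "D u v" "\<not> F (u + v)"
  shows "u + v \<in> A"
  using assms unfolding stable_def by blast

text \<open>If the third point of the join is off the surface, the join is tangent at
  \<open>u\<close>, because it is not tangent at \<open>v\<close>. Otherwise the secant through
  \<open>u\<close> and the third point returns \<open>v\<close>.\<close>

lemma stable_transversal:
  assumes A: "stable A" "u \<in> A" and "\<not> F u" "\<not> F v" "D v u" and sum: "F (u + v) \<or> u + v \<in> A"
  shows "v \<in> A"
proof (cases "F (u + v)")
  case True
  then have "\<not> D u v" using F_add[of u v] assms by auto
  then show ?thesis using stable_tangent A True assms by blast
next
  case False
  then have "D u (u + v)" using F_add[of u v] D_add[of u u v] D_self[of u] assms by auto
  moreover have "\<not> F (u + (u + v))" using assms by (simp add: add_self_left)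
  ultimately have "u + (u + v) \<in> A" using stable_secant A sum False by blast
  then show ?thesis by (simp add: add_self_left)
qed

lemma spans_trans: "spans u v \<Longrightarrow> spans v w \<Longrightarrow> spans u w"
  by (simp add: spans_def)

lemma spans_refl: "spans u u"
  by (simp add: spans_def)

end

section \<open>The surface around a line contained in it\<close>

locale binary_cubic_line = binary_cubic F D for F :: "'v::ab_group_add \<Rightarrow> bool" and D +
  fixes r s :: 'v
  assumes F_r: "\<not> F r" and F_s: "\<not> F s" and D_r_s: "\<not> D r s" and D_s_r: "\<not> D s r"
    and r_nz: "r \<noteq> 0" and s_nz: "s \<noteq> 0" and r_neq_s: "r \<noteq> s"
begin

abbreviation "line \<equiv> {0, r, s, r + s}"

lemma F_rs: "\<not> F (r + s)"
  using F_add[of r s] F_r F_s D_r_s D_s_r by simp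

lemma D_line:
  "\<not> D r r" "\<not> D s s" "\<not> D (r + s) r" "\<not> D (r + s) s"
proof -
  show 1: "\<not> D r r" "\<not> D s s" using D_self F_r F_s by auto
  have "F (r + s + r) = F s" "F (r + s + s) = F r" by (simp_all add: char2_simps)
  then show "\<not> D (r + s) r" "\<not> D (r + s) s"
    using F_add[of "r+s" r] F_add[of "r+s" s] F_r F_s F_rs D_add[of r r s] D_add[of s r s] 1 D_r_s D_s_r
    by auto
qed

lemmas line_facts = F_r F_s D_r_s D_s_r F_rs D_line

lemma F_r_add: "F (v + r) \<longleftrightarrow> (F v \<noteq> (D r v \<noteq> D v r))"
  and F_s_add: "F (v + s) \<longleftrightarrow> (F v \<noteq> (D s v \<noteq> D v s))"
  and F_rs_add: "F (v + r + s) \<longleftrightarrow> (F v \<noteq> (D (r + s) v \<noteq> (D v r \<noteq> D v s)))"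
  using F_add[of v r] F_add[of v s] F_add[of v "r + s"] D_add[of v r s]
  by (auto simp: line_facts add.assoc)

lemma third_point:
  "r + s \<noteq> 0" "r + s \<noteq> r" "r + s \<noteq> s" "r + (r + s) = s" "s + (r + s) = r" "r + s + r = s" "r + s + s = r"
proof -
  show "r + s \<noteq> 0" using r_neq_s add_eq_0_iff by blast
  show "r + s \<noteq> r" "r + s \<noteq> s" using r_nz s_nz by simp_all
  show "r + (r + s) = s" "s + (r + s) = r" "r + s + r = s" "r + s + s = r"
    by (simp_all add: char2_simps)
qed

lemma D_r_line: "D r (v + r) = D r v" "D r (v + s) = D r v"
  and D_s_line: "D s (v + r) = D s v" "D s (v + s) = D s v"
  and D_rs_line: "D (r + s) (v + r) = D (r + s) v" "D (r + s) (v + s) = D (r + s) v"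
  by (simp_all add: D_add line_facts)

lemma D_line_mem: "w \<in> line \<Longrightarrow> \<not> D u r \<Longrightarrow> \<not> D u s \<Longrightarrow> \<not> D u w"
  by (auto simp: D_add D_0)

lemma in_line_add: "v + w \<in> line \<Longrightarrow> w = v \<or> w = v + r \<or> w = v + s \<or> w = v + r + s"
  by (metis add_self_left add.assoc add_0_right empty_iff insert_iff)

text \<open>The point \<open>f\<close> is where the join of the two other rational points of the conic meets the line.\<close>

lemma smooth_conic_step:
  assumes ker: "\<And>v. \<not> D r v \<Longrightarrow> \<not> D s v \<Longrightarrow> v \<in> line"
    and e: "\<not> D r e" "D s e" "D (r + s) e" "D e r"
  obtains f where "f \<in> {s, r + s}" "spans r f"
    "\<And>v. \<not> F v \<Longrightarrow> \<not> D r v \<Longrightarrow> D s v \<Longrightarrow> spans r v"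
proof -
  have "F (e + r) \<longleftrightarrow> \<not> F e" "F (e + r + s) \<longleftrightarrow> \<not> F (e + s)"
    using F_r_add[of e] F_s_add[of e] F_rs_add[of e] e by auto
  \<comment> \<open>By \<open>D e r\<close> the form changes under adding \<open>r\<close> to a
    point of \<open>e + line\<close>. So exactly two of the four points are zeros, they do not
    differ by \<open>r\<close>, and \<open>q\<close> is one of them.\<close>
  then obtain q where q: "\<not> D r q" "D s q" "D (r + s) q" "\<not> F q" "F (q + r)"
    "F (q + r + s) \<longleftrightarrow> \<not> F (q + s)"
    using e D_r_line[of e] D_s_line[of e] D_rs_line[of e]
    by (cases "F e") (use add_self add.assoc in \<open>auto simp: char2_simps\<close>)
  define f where "f = (if F (q + s) then r + s else s)"
  have f: "f \<in> {s, r + s}" "\<not> F f" "\<not> F (q + f)" "F (r + (q + f))"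
    using q by (auto simp: f_def line_facts add.assoc add.commute add.left_commute add_self_left)
  have dq: "\<not> D r (q + f)" using f q by (auto simp: D_add line_facts)
  have 1: "q \<in> A" "q + f \<in> A" if "stable A" "r \<in> A" for A
    using stable_tangent[OF that, of q] stable_tangent[OF that, of "q + f"] q f dq
    by (simp_all add: add.commute)
  have "D f q" using f q by auto
  then have "D q f" using F_add[of q f] q f by auto
  then have "D q (q + f)" using D_add[of q q f] D_self[of q] q by auto
  then have 2: "f \<in> A" if "stable A" "r \<in> A" for A
    using stable_secant[OF that(1) 1(1)[OF that] 1(2)[OF that]] f by (simp add: add_self_left)
  show ?thesis
  proof (rule that)
    show "f \<in> {s, r + s}" by (rule f)
    show "spans r f" using 2 by (auto simp: spans_def)
    fix v assume v: "\<not> F v" "\<not> D r v" "D s v"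
    then have "q + v \<in> line" using q by (intro ker) (auto simp: D_add)
    then have "v = q \<or> v = q + r \<or> v = q + s \<or> v = q + r + s" by (rule in_line_add)
    then have "v = q \<or> v = q + f" using v q by (auto simp: f_def add.assoc split: if_splits)
    then show "spans r v" using 1 by (auto simp: spans_def)
  qed
qed

text \<open>In the sum of \<open>F\<close> over a coset of the line the terms \<open>D v r\<close>
  and \<open>D v s\<close> cancel, which leaves the sum of the three tangent functionals at
  \<open>v\<close>. If it is 1, one truth value occurs once and the other three times;
  \<open>w\<close> carries the lone one.\<close>

lemma F_coset_odd:
  assumes "D r v \<noteq> (D s v \<noteq> D (r + s) v)"
  obtains w where "w \<in> {v, v + r, v + s, v + r + s}"
    "F (w + r) \<longleftrightarrow> \<not> F w" "F (w + s) \<longleftrightarrow> \<not> F w" "F (w + r + s) \<longleftrightarrow> \<not> F w"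
proof -
  have "F v \<noteq> (F (v + r) \<noteq> (F (v + s) \<noteq> F (v + r + s)))"
    using F_r_add[of v] F_s_add[of v] F_rs_add[of v] assms by auto
  then have "\<exists>w \<in> {v, v + r, v + s, v + r + s}.
    (F (w + r) \<longleftrightarrow> \<not> F w) \<and> (F (w + s) \<longleftrightarrow> \<not> F w) \<and> (F (w + r + s) \<longleftrightarrow> \<not> F w)"
    by (simp add: char2_simps) argo
  then show ?thesis using that by blast
qed

text \<open>The residual conic is here a double line with rational points \<open>r\<close>,
  \<open>w\<close> and \<open>w + r\<close>, and its plane is tangent to the surface at
  \<open>w\<close> and \<open>w + r\<close> too. Smoothness will contradict this in
  \<open>double_line_singular\<close>.\<close>

lemma double_line:
  assumes v: "\<not> D r v" "D s v" "D (r + s) v" "\<not> D v r" "\<not> D v s"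
  obtains w where "D s w" "\<not> F w" "\<not> D r w"
    "\<not> D w r" "\<not> D w s" "\<not> D w w" "\<not> D (w + r) r" "\<not> D (w + r) s" "\<not> D (w + r) w"
proof -
  \<comment> \<open>On this coset adding \<open>s\<close> flips \<open>F\<close> and adding
    \<open>r\<close> preserves it, so one of \<open>v\<close> and \<open>v + s\<close> is a
    zero.\<close>
  define w where "w = (if F v then v + s else v)"
  have F_v: "F (v + s) \<longleftrightarrow> \<not> F v" "F (v + r) \<longleftrightarrow> F v" "F (v + r + s) \<longleftrightarrow> \<not> F v"
    using F_r_add[of v] F_s_add[of v] F_rs_add[of v] v by blast+
  have cancel: "v + s + r = v + r + s" "v + s + s = v" "v + r + s + s = v + r"
    by (simp_all add: char2_simps)
  have F: "\<not> F w" "\<not> F (w + r)" "F (w + s)" "F (w + r + s)"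
  proof -
    have "\<not> F w \<and> \<not> F (w + r) \<and> F (w + s) \<and> F (w + r + s)"
    proof (cases "F v")
      case True
      then have w_eq: "w = v + s" by (simp add: w_def)
      show ?thesis using True F_v unfolding w_eq cancel by blast
    next
      case False
      then have w_eq: "w = v" by (simp add: w_def)
      show ?thesis using False F_v unfolding w_eq by blast
    qed
    then show "\<not> F w" "\<not> F (w + r)" "F (w + s)" "F (w + r + s)" by blast+
  qed
  have Dw: "\<not> D r w" "D s w" "D (r + s) w" using v by (auto simp: w_def D_r_line D_s_line D_rs_line)
  have wrr: "w + r + r = w" by (simp add: char2_simps)
  have 1: "\<not> D w r" "\<not> D w s" "\<not> D w w"
    using F_r_add[of w] F_s_add[of w] D_self[of w] F Dw by blast+
  have 2: "\<not> D (w + r) r" "\<not> D (w + r) s"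
    using F_r_add[of "w + r"] F_s_add[of "w + r"] F Dw unfolding wrr D_r_line D_s_line by blast+
  then have "\<not> D (w + r) w" using D_add[of "w + r" w r] D_self[of "w + r"] F by blast
  with 1 2 F Dw show ?thesis using that[of w] by blast
qed

end

section \<open>Two coinciding tangent planes along the line\<close>

text \<open>The points \<open>r\<close> and \<open>s\<close> share their tangent plane, and the conic tangent to the line at \<open>r + s\<close>
  has the further points \<open>q\<close> and \<open>q + r\<close>.\<close>

locale folded_line = binary_cubic_line F D r s for F :: "'v::ab_group_add \<Rightarrow> bool" and D r s +
  fixes q :: 'v
  assumes D_s_eq: "D s v = D r v"
    and ker: "\<not> D r v \<Longrightarrow> \<not> D (r + s) v \<Longrightarrow> v \<in> line"
    and smooth: "\<not> F u \<Longrightarrow> u \<noteq> 0 \<Longrightarrow> \<exists>v. D u v"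
    and q: "D r q" "\<not> D (r + s) q" "\<not> F q" "\<not> F (q + r)" "F (q + s)" "F (q + r + s)"
begin

lemma D_q_r: "D q r"
  using F_r_add[of q] q by auto

text \<open>The planes through the line are numbered by the values of \<open>D r\<close> and
  \<open>D (r + s)\<close>: 0, 1 in plane 1, then 1, 0 in plane 2, and 1, 1 in plane 3. By
  \<open>ker\<close>, each of them is a single coset outside the line.\<close>

lemma zeros_plane2:
  assumes "D r v" "\<not> D (r + s) v" "\<not> F v"
  shows "v = q \<or> v = q + r"
proof -
  have "q + v \<in> line" using q assms by (intro ker) (auto simp: D_add)
  from in_line_add[OF this] show ?thesis using assms q by auto
qed

text \<open>The classes of \<open>q\<close> and \<open>b\<close> form a basis modulo the line, so a
  nonzero functional that kills the line cannot kill both.\<close>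

lemma tangent_nonzero:
  assumes u: "\<not> F u" "u \<noteq> 0" "\<not> D u r" "\<not> D u s" and b: "\<not> D r b" "D (r + s) b"
  shows "D u q \<or> D u b"
proof (rule ccontr)
  assume n: "\<not> ?thesis"
  obtain v where v: "D u v" using smooth u by blast
  define w where "w = v + (if D r v then q else 0) + (if D (r + s) v then b else 0)"
  have "w \<in> line" using q b by (intro ker) (auto simp: w_def D_add D_0)
  then have "\<not> D u w" using u(3,4) by (rule D_line_mem)
  then show False using v n by (auto simp: w_def D_add D_0 split: if_splits)
qed

text \<open>Plane 2 is tangent at \<open>r + s\<close>, which gives \<open>q\<close> and
  \<open>q + r\<close>; their join meets the line in \<open>r\<close>.\<close>

lemma spans_from_rs:
  assumes A: "stable A" "r + s \<in> A"
  shows "q \<in> A" "q + r \<in> A" "r \<in> A"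
proof -
  show 1: "q \<in> A" "q + r \<in> A"
    using stable_tangent[OF A, of q] stable_tangent[OF A, of "q + r"] q D_rs_line[of q]
    by (simp_all add: char2_simps)
  have "D q (q + r)" using D_q_r D_add[of q q r] D_self[of q] q by auto
  then show "r \<in> A" using stable_secant[OF A(1) 1] F_r by (simp add: add_self_left)
qed

text \<open>The conic of plane 1 is smooth with rational points \<open>r\<close>, \<open>s\<close>,
  \<open>t\<close>, and its tangent at \<open>t\<close> meets the line in \<open>r + s\<close>. So
  \<open>s\<close> yields \<open>t\<close>, then \<open>r + s\<close>, then plane 2. In plane 3 the
  form takes its lone value at \<open>n\<close>.\<close>

lemma spans_all_conic:
  assumes t: "\<not> D r t" "D (r + s) t" "\<not> F t" "F (t + r)" "F (t + s)" "F (t + r + s)"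
    and n: "D r n" "D (r + s) n"
      "F (n + r) \<longleftrightarrow> \<not> F n" "F (n + s) \<longleftrightarrow> \<not> F n" "F (n + r + s) \<longleftrightarrow> \<not> F n"
    and A: "stable A" "s \<in> A" and v: "\<not> F v" "v \<noteq> 0"
  shows "v \<in> A"
proof -
  have tX: "t \<in> A" using stable_tangent[OF A, of t] t D_s_eq by (simp add: add.commute)
  have "\<not> D t (r + s)" using F_add[of t "r + s"] F_rs t by (auto simp: add.assoc)
  then have pX: "r + s \<in> A" using stable_tangent[OF A(1) tX, of "r + s"] t F_rs by (simp add: add.assoc)
  note qX = spans_from_rs[OF A(1) pX]
  have plane1: "w \<in> A" if "\<not> D r w" "D (r + s) w" "\<not> F w" for w
  proof -
    have "t + w \<in> line" using t that by (intro ker) (auto simp: D_add)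
    from in_line_add[OF this] show ?thesis using t that tX by auto
  qed
  \<comment> \<open>The sum of a point of plane 2 and a point of plane 3 lies in plane 1, whose
    zeros are already reached, so \<open>stable_transversal\<close> applies from \<open>q\<close> or
    from \<open>q + r\<close>.\<close>
  have q_step: "w \<in> A" if "D r w" "D (r + s) w" "\<not> F w" "D w q \<or> D w r" for w
  proof (cases "D w q")
    case True
    have "F (q + w) \<or> q + w \<in> A" using q that by (auto intro: plane1 simp: D_add)
    then show ?thesis using stable_transversal[OF A(1) qX(1)] True q that by blast
  next
    case False
    then have "D w (q + r)" using that by (auto simp: D_add)
    moreover have "F (q + r + w) \<or> q + r + w \<in> A"
      using q that by (auto intro: plane1 simp: D_add line_facts)
    ultimately show ?thesis using stable_transversal[OF A(1) qX(2)] q that by blast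
  qed
  have plane3: "w \<in> A" if w: "D r w" "D (r + s) w" "\<not> F w" for w
  proof -
    have "n + w \<in> line" using n w by (intro ker) (auto simp: D_add)
    note wn = in_line_add[OF this]
    show ?thesis
    proof (cases "F n")
      \<comment> \<open>Now \<open>n\<close> is the only rational point of its conic and the plane
        is tangent there, so smoothness of the surface makes \<open>D n\<close> nonzero on
        \<open>q\<close>.\<close>
      case False
      then have w_eq: "w = n" using wn w n by auto
      have "\<not> D n r" "\<not> D n s" using F_r_add[of n] F_s_add[of n] n False D_s_eq by auto
      moreover have "n \<noteq> 0" using n D_0 by auto
      ultimately have "D n q \<or> D n (q + n)" using tangent_nonzero[of n "q + n"] False n q
        by (auto simp: D_add)
      then have "D n q" using D_self[of n] False by (auto simp: D_add)
      then show ?thesis using q_step w w_eq by blast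
    next
      \<comment> \<open>Two of the three zeros are transversal to \<open>r\<close>; the remaining
        one is on the secant through \<open>r + s\<close> and \<open>n + s\<close>.\<close>
      case True
      have "D (n + s) r" using F_r_add[of "n + s"] n True D_r_line[of n] by (simp add: char2_simps)
      then have 1: "n + s \<in> A" using q_step[of "n + s"] n True D_r_line D_rs_line by auto
      have "D (n + r + s) r" using F_r_add[of "n + r + s"] n True D_r_line[of n] D_r_line[of "n + r"]
        by (simp add: char2_simps)
      then have 2: "n + r + s \<in> A"
        using q_step[of "n + r + s"] n True D_r_line D_rs_line by auto
      have "D (r + s) (n + s)" using n D_rs_line by auto
      then have 3: "n + r \<in> A"
        using stable_secant[OF A(1) pX 1] n True by (simp add: char2_simps)
      show ?thesis using wn w True 1 2 3 by auto
    qed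
  qed
  show ?thesis
  proof (cases "D r v"; cases "D (r + s) v")
    assume "\<not> D r v" "\<not> D (r + s) v"
    then show ?thesis using ker[of v] v A pX qX by auto
  qed (use v plane1 plane3 zeros_plane2 qX in blast)+
qed

text \<open>The conic of plane 1 is the pair of lines joining \<open>b\<close> to \<open>r\<close>
  and to \<open>s\<close>. The points \<open>b + r\<close> and \<open>b + s\<close> take over the
  part of \<open>q\<close> and \<open>q + r\<close>, with plane 2 as the plane already exhausted;
  \<open>b\<close> and \<open>s\<close> are reached only after a point of plane 3.\<close>

lemma spans_all_lines:
  assumes b: "\<not> D r b" "D (r + s) b" "\<not> F b" "\<not> F (b + r)" "\<not> F (b + s)" "F (b + r + s)"
    and n: "D r n" "D (r + s) n"
      "F (n + r) \<longleftrightarrow> \<not> F n" "F (n + s) \<longleftrightarrow> \<not> F n" "F (n + r + s) \<longleftrightarrow> \<not> F n"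
    and A: "stable A" "r + s \<in> A" and v: "\<not> F v" "v \<noteq> 0"
  shows "v \<in> A"
proof -
  note qX = spans_from_rs[OF A]
  have bsX: "b + s \<in> A" using stable_tangent[OF A(1) qX(3), of "b + s"] b D_r_line
    by (simp add: char2_simps)
  have "D (r + s) (b + s)" using b D_rs_line by auto
  then have brX: "b + r \<in> A" using stable_secant[OF A bsX] b by (simp add: char2_simps)
  have Db: "\<not> D b r" "\<not> D b s" using F_r_add[of b] F_s_add[of b] b D_s_eq by auto
  have bnz: "b \<noteq> 0" using b D_0 by auto
  have "D b q" using tangent_nonzero[of b b] b Db bnz D_self[of b] by auto
  \<comment> \<open>The three nonzero classes modulo the line are those of \<open>b\<close>,
    \<open>q\<close> and \<open>n\<close>, and they sum to zero.\<close>
  have "b + q + n \<in> line" using b q n by (intro ker) (auto simp: D_add)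
  then have "\<not> D b (b + q + n)" using Db by (rule D_line_mem)
  then have Dbn: "D b n" using D_self[of b] b \<open>D b q\<close> by (auto simp: D_add)
  have plane2: "w \<in> A" if "D r w" "\<not> D (r + s) w" "\<not> F w" for w
    using zeros_plane2[OF that] qX by auto
  have b_step: "w \<in> A" if w: "D r w" "D (r + s) w" "\<not> F w" "D w (b + r) \<or> D w (b + s)" for w
  proof -
    have "F (b + r + w) \<or> b + r + w \<in> A" "F (b + s + w) \<or> b + s + w \<in> A"
      using b w by (auto intro: plane2 simp: D_add line_facts)
    then show ?thesis
      using stable_transversal[OF A(1) brX, of w] stable_transversal[OF A(1) bsX, of w] b w by blast
  qed
  have b_mem: "b \<in> A" if "w \<in> A" "D r w" "D (r + s) w" "\<not> F w" "D b w" for w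
  proof -
    have "F (w + b) \<or> w + b \<in> A" using b that by (auto intro: plane2 simp: D_add)
    then show ?thesis using stable_transversal[OF A(1), of w b] b that by blast
  qed
  have rest: "s \<in> A \<and> b \<in> A \<and> (\<forall>w. D r w \<longrightarrow> D (r + s) w \<longrightarrow> \<not> F w \<longrightarrow> w \<in> A)"
  proof (cases "F n")
    case False
    have Dn: "\<not> D n r" "\<not> D n s" using F_r_add[of n] F_s_add[of n] n False D_s_eq by auto
    moreover have "n \<noteq> 0" using n D_0 by auto
    ultimately have "D n q \<or> D n (q + n)" using tangent_nonzero[of n "q + n"] False n q
      by (auto simp: D_add)
    then have "D n q" using D_self[of n] False by (auto simp: D_add)
    moreover have "\<not> D n (b + q + n)" using \<open>b + q + n \<in> line\<close> Dn by (rule D_line_mem)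
    ultimately have "D n (b + r)" using D_self[of n] False Dn by (auto simp: D_add)
    then have nX: "n \<in> A" using b_step n False by blast
    moreover have "s \<in> A" using stable_tangent[OF A(1) nX, of s] Dn n False F_s by auto
    moreover have "b \<in> A" using b_mem[OF nX] n False Dbn by auto
    moreover have "w = n" if w: "D r w" "D (r + s) w" "\<not> F w" for w
    proof -
      have "n + w \<in> line" using n w by (intro ker) (auto simp: D_add)
      from in_line_add[OF this] show ?thesis using w n False by auto
    qed
    ultimately show ?thesis by blast
  next
    case True
    have Fn: "F n" "\<not> F (n + r)" "\<not> F (n + s)" "\<not> F (n + r + s)" using n True by auto
    have Dn: "D (n + r) s" "\<not> D (n + r) r" "\<not> D (n + s) s" "D (n + s) r"
      using F_s_add[of "n + r"] F_r_add[of "n + r"] F_s_add[of "n + s"] F_r_add[of "n + s"]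
        Fn n D_r_line[of n] D_s_eq
      by (simp_all add: char2_simps)
    \<comment> \<open>The functional \<open>D (n + r)\<close> separates \<open>r\<close> from
      \<open>s\<close>, hence \<open>b + r\<close> from \<open>b + s\<close>, so it is nonzero on
      one of the latter.\<close>
    have 1: "n + r \<in> A"
      using b_step[of "n + r"] Dn Fn n D_r_line D_rs_line by (auto simp: D_add)
    have 2: "n + s \<in> A"
      using b_step[of "n + s"] Dn Fn n D_r_line D_rs_line by (auto simp: D_add)
    have "D r (n + s)" using n D_r_line by auto
    then have 3: "n + r + s \<in> A"
      using stable_secant[OF A(1) qX(3) 2] Fn by (simp add: char2_simps)
    have "D (n + r) (n + r + s)" using Dn D_self[of "n + r"] Fn by (simp add: D_add)
    then have "s \<in> A"
      using stable_secant[OF A(1) 1 3] F_s by (simp add: char2_simps)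
    moreover have "b \<in> A" using b_mem[OF 1] n Fn Dbn Db D_r_line D_rs_line by (auto simp: D_add)
    moreover have "w \<in> A" if w: "D r w" "D (r + s) w" "\<not> F w" for w
    proof -
      have "n + w \<in> line" using n w by (intro ker) (auto simp: D_add)
      from in_line_add[OF this] show ?thesis using w Fn 1 2 3 by auto
    qed
    ultimately show ?thesis by blast
  qed
  show ?thesis
  proof (cases "D r v"; cases "D (r + s) v")
    assume "\<not> D r v" "\<not> D (r + s) v"
    then show ?thesis using ker[of v] v A qX rest by auto
  next
    assume "\<not> D r v" "D (r + s) v"
    then have "b + v \<in> line" using b by (intro ker) (auto simp: D_add)
    from in_line_add[OF this] show ?thesis using v b brX bsX rest by auto
  qed (use rest v plane2 in blast)+
qed

text \<open>On planes 1 and 3 the three functionals sum to 1, so \<open>F_coset_odd\<close> supplies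
  \<open>b\<close> and \<open>n\<close>. If \<open>b\<close> is a lone zero, the conic of plane 1 is
  smooth and \<open>s\<close> spans; if it is a lone nonzero, the conic is a pair of lines and
  \<open>r + s\<close> spans.\<close>

lemma spans_all_folded:
  assumes "\<not> D r e" "D (r + s) e"
  obtains P where "P \<in> {r, s, r + s}" "\<And>v. \<not> F v \<Longrightarrow> v \<noteq> 0 \<Longrightarrow> spans P v"
proof -
  have sum1: "D r v \<noteq> (D s v \<noteq> D (r + s) v)" if "D (r + s) v" for v
    using that D_s_eq by auto
  obtain b where b: "b \<in> {e, e + r, e + s, e + r + s}"
    "F (b + r) \<longleftrightarrow> \<not> F b" "F (b + s) \<longleftrightarrow> \<not> F b" "F (b + r + s) \<longleftrightarrow> \<not> F b"
    using F_coset_odd[OF sum1[OF assms(2)]] by blast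
  have b': "\<not> D r b" "D (r + s) b" using b(1) assms by (auto simp: D_r_line D_rs_line)
  have "D (r + s) (q + e)" using q assms by (simp add: D_add)
  from F_coset_odd[OF sum1[OF this]] obtain n where n: "n \<in> {q + e, q + e + r, q + e + s, q + e + r + s}"
    "F (n + r) \<longleftrightarrow> \<not> F n" "F (n + s) \<longleftrightarrow> \<not> F n" "F (n + r + s) \<longleftrightarrow> \<not> F n"
    by blast
  have n': "D r n" "D (r + s) n" using n(1) assms q by (auto simp: D_r_line D_rs_line D_add line_facts)
  show ?thesis
  proof (cases "F b")
    case False
    then have t: "\<not> F b" "F (b + r)" "F (b + s)" "F (b + r + s)" using b(2-4) by blast+
    have "spans s v" if "\<not> F v" "v \<noteq> 0" for v
      unfolding spans_def using spans_all_conic[OF b' t n' n(2-4) _ _ that] by blast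
    then show ?thesis using that[of s] by blast
  next
    case True
    \<comment> \<open>This is the common point of the two lines.\<close>
    define c where "c = b + r + s"
    have c_add: "c + r = b + s" "c + s = b + r" "b + s + s = b"
      by (simp_all add: c_def char2_simps)
    have c: "\<not> D r c" "D (r + s) c" "\<not> F c" "\<not> F (c + r)" "\<not> F (c + s)" "F (c + r + s)"
      unfolding c_add using b(2-4) b' True by (simp_all add: c_def D_r_line D_rs_line)
    have "spans (r + s) v" if "\<not> F v" "v \<noteq> 0" for v
      unfolding spans_def using spans_all_lines[OF c n' n(2-4) _ _ that] by blast
    then show ?thesis using that[of "r + s"] by blast
  qed
qed

end

section \<open>The cases for a line without rational Eckardt points\<close>

text \<open>Assumption \<open>not_eckardt\<close> says that if the residual conic in the plane through the line and \<open>v\<close> is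
  tangent to the line at \<open>u\<close>, then it is smooth there.\<close>

locale eckardt_free_line = binary_cubic_line F D r s for F :: "'v::ab_group_add \<Rightarrow> bool" and D r s +
  fixes d e :: 'v
  assumes span: "v \<in> line \<or> v + d \<in> line \<or> v + e \<in> line \<or> v + (d + e) \<in> line"
    and smooth: "\<not> F u \<Longrightarrow> u \<noteq> 0 \<Longrightarrow> \<exists>v. D u v"
    and not_const: "\<exists>v. D r v \<noteq> D s v \<or> D s v \<noteq> D (r + s) v"
    and not_eckardt: "u \<in> line \<Longrightarrow> u' \<in> line \<Longrightarrow> u \<noteq> 0 \<Longrightarrow> u' \<noteq> 0 \<Longrightarrow> u \<noteq> u' \<Longrightarrow> v \<notin> line \<Longrightarrow>
      \<not> D u v \<Longrightarrow> D u' v \<Longrightarrow> D (u + u') v \<Longrightarrow> D v u"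
begin

text \<open>The truth values \<open>i\<close> and \<open>j\<close> are the coordinates of
  \<open>v\<close> modulo the line in the basis \<open>d\<close>, \<open>e\<close>; functionals at
  points of the line kill the line and see only these.\<close>

lemma tangent_coords:
  obtains i j where "\<not> i \<Longrightarrow> \<not> j \<Longrightarrow> v \<in> line"
    "\<And>u. u \<in> line \<Longrightarrow> D u v \<longleftrightarrow> ((i \<and> D u d) \<noteq> (j \<and> D u e))"
proof -
  have 1: "D u w = D u x" if "w + x \<in> line" "u \<in> line" for u w x
    using D_line_mem[OF that(1), of u] that(2) by (auto simp: D_add line_facts D_0 D_0_left)
  have 2: "\<not> D u v" if "v \<in> line" "u \<in> line" for u
    using D_line_mem[OF that(1), of u] that(2) by (auto simp: D_add line_facts D_0 D_0_left)
  from span[of v] consider "v \<in> line" | "v + d \<in> line" | "v + e \<in> line" | "v + (d + e) \<in> line"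
    by blast
  then show ?thesis
  proof cases
    case 1
    then show ?thesis using 2 that[of False False] by blast
  next
    case 2
    then show ?thesis using 1 that[of True False] by blast
  next
    case 3
    then show ?thesis using 1 that[of False True] by blast
  next
    case 4
    then show ?thesis using 1 D_add that[of True True] by blast
  qed
qed

lemma tangent_planes:
  assumes "u \<in> {r, s, r + s}"
  shows "D u d \<or> D u e"
proof -
  have "u \<noteq> 0" "\<not> F u" "u \<in> line" using assms r_nz s_nz third_point F_r F_s F_rs by auto
  then obtain v where "D u v" using smooth by blast
  then show ?thesis using tangent_coords[of v] \<open>u \<in> line\<close> by metis
qed

lemma tangent_neq:
  assumes "D u v \<noteq> D u' v" "u \<in> line" "u' \<in> line"
  shows "D u d \<noteq> D u' d \<or> D u e \<noteq> D u' e"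
  using tangent_coords[of v] assms by metis

text \<open>Two distinct nonzero functionals over the field with two elements are independent, so on
  a two-dimensional quotient they have no common zero but 0.\<close>

lemma kernel:
  assumes "u \<in> {r, s, r + s}" "u' \<in> {r, s, r + s}" "D u d \<noteq> D u' d \<or> D u e \<noteq> D u' e"
    and "\<not> D u v" "\<not> D u' v"
  shows "v \<in> line"
proof -
  have "u \<in> line" "u' \<in> line" using assms by blast+
  then show ?thesis
    using tangent_coords[of v] tangent_planes[OF assms(1)] tangent_planes[OF assms(2)] assms(3-5)
    by metis
qed

lemma folded_line_spans:
  assumes eq: "\<And>v. D s v = D r v"
  obtains P where "P \<in> {r, s, r + s}" "\<And>v. \<not> F v \<Longrightarrow> v \<noteq> 0 \<Longrightarrow> spans P v"
proof -
  have nc: "D r d \<noteq> D (r + s) d \<or> D r e \<noteq> D (r + s) e"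
  proof -
    obtain v where "D r v \<noteq> D (r + s) v" using not_const eq by blast
    then show ?thesis by (rule tangent_neq) auto
  qed
  have ker: "v \<in> line" if "\<not> D r v" "\<not> D (r + s) v" for v
    using kernel[of r "r + s" v] nc that by blast
  have vals: "\<exists>v. D r v = x \<and> D (r + s) v = y" if "x \<or> y" for x y
    using nc tangent_planes[of r] tangent_planes[of "r + s"] that
      D_add[of r d e] D_add[of "r + s" d e] by (cases x; cases y; auto)
  obtain g where g: "\<not> D r g" "D (r + s) g" using vals[of False True] by auto
  obtain h where h: "D r h" "\<not> D (r + s) h" using vals[of True False] by auto
  \<comment> \<open>The plane of \<open>h\<close> is tangent at \<open>r + s\<close> and not at
    \<open>r\<close> or \<open>s\<close>. Without an Eckardt point its conic is smooth there, which
    leaves two zeros \<open>q\<close> and \<open>q + r\<close>, or \<open>q\<close> and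
    \<open>q + s\<close>.\<close>
  have "D h (r + s)"
    using not_eckardt[of "r + s" r h] h r_nz s_nz r_neq_s D_line_mem[of h r] eq[of h]
    by (auto simp: add_eq_0_iff line_facts char2_simps)
  then have "D h r \<noteq> D h s" by (simp add: D_add)
  then have F_h: "F (h + r) \<noteq> F (h + s)" "F (h + r + s) \<longleftrightarrow> \<not> F h"
    using F_r_add[of h] F_s_add[of h] F_rs_add[of h] h eq[of h] by auto
  obtain q where q: "D r q" "\<not> D (r + s) q" "\<not> F q" "F (q + r + s)" "F (q + r) \<noteq> F (q + s)"
  proof (cases "F h")
    case True
    have eq: "h + r + s + r = h + s" "h + r + s + s = h + r" "h + s + s = h"
      by (simp_all add: char2_simps)
    show ?thesis
      by (rule that[of "h + r + s"], unfold eq) (use True h F_h in \<open>auto simp: D_r_line D_rs_line\<close>)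
  next
    case False
    then show ?thesis using h F_h that[of h] by simp
  qed
  show ?thesis
  proof (cases "F (q + r)")
    case False
    interpret folded_line F D r s q
      using False q eq ker smooth by unfold_locales auto
    show ?thesis using spans_all_folded g that by metis
  next
    \<comment> \<open>The second zero is \<open>q + s\<close>, so \<open>r\<close> and
      \<open>s\<close> exchange roles.\<close>
    case True
    have "binary_cubic_line F D s r"
      using line_facts r_nz s_nz r_neq_s by unfold_locales auto
    then interpret sw: binary_cubic_line F D s r .
    have "sw.line = line" by (auto simp: add.commute)
    interpret sw: folded_line F D s r q
      using True q eq ker smooth by unfold_locales (auto simp: ac_simps)
    show ?thesis using sw.spans_all_folded g eq that by (metis add.commute insert_commute)
  qed
qed

text \<open>Three distinct nonzero functionals on a two-dimensional space over the field with two
  elements sum to zero. So every point off the line lies in the tangent plane at exactly one of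
  \<open>r\<close>, \<open>s\<close>, \<open>r + s\<close>, and it is reached from there.\<close>

lemma smooth_conics_span:
  assumes ne: "\<exists>v. D r v \<noteq> D s v" "\<exists>v. D r v \<noteq> D (r + s) v" "\<exists>v. D s v \<noteq> D (r + s) v"
  obtains P where "P \<in> {r, s, r + s}" "\<And>v. \<not> F v \<Longrightarrow> v \<noteq> 0 \<Longrightarrow> spans P v"
proof -
  have coords: "D r d \<noteq> D s d \<or> D r e \<noteq> D s e" "D r d \<noteq> D (r + s) d \<or> D r e \<noteq> D (r + s) e"
    "D s d \<noteq> D (r + s) d \<or> D s e \<noteq> D (r + s) e"
    using ne tangent_neq[of r _ s] tangent_neq[of r _ "r + s"] tangent_neq[of s _ "r + s"] by blast+
  note planes = tangent_planes[of r] tangent_planes[of s] tangent_planes[of "r + s"]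
  have ker: "v \<in> line" if "\<not> D r v \<and> \<not> D s v \<or> \<not> D s v \<and> \<not> D r v \<or> \<not> D (r + s) v \<and> \<not> D r v" for v
    using kernel[of r s v] kernel[of r "r + s" v] coords that by blast
  have sum: "D (r + s) v \<longleftrightarrow> (D r v \<noteq> D s v)" for v
  proof -
    obtain i j where ij: "u \<in> line \<Longrightarrow> D u v \<longleftrightarrow> ((i \<and> D u d) \<noteq> (j \<and> D u e))" for u
      using tangent_coords[of v] by metis
    show ?thesis using ij[of r] ij[of s] ij[of "r + s"] coords planes by simp argo
  qed
  have ex: "\<exists>v. D r v = x \<and> D s v = y" for x y
    using coords(1) planes(1,2) D_add[of r d e] D_add[of s d e] D_0[of r] D_0[of s]
    by (cases x; cases y; auto)
  have step: "\<exists>f \<in> {r, s, r + s}. f \<noteq> u \<and> spans u f \<and>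
      (\<forall>v. \<not> F v \<longrightarrow> \<not> D u v \<longrightarrow> v \<notin> line \<longrightarrow> spans u v)"
    if u: "(u, u') \<in> {(r, s), (s, r), (r + s, r)}" for u u'
  proof -
    have S: "{u, u', u + u'} = {r, s, r + s}" using u by (auto simp: third_point add.commute[of s r])
    have u_mem: "u \<in> line" "u' \<in> line" "u \<noteq> 0" "u' \<noteq> 0" "u \<noteq> u'" "\<not> F u" "\<not> F u'"
      "\<not> D u u'" "\<not> D u' u"
      using u r_nz s_nz r_neq_s by (auto simp: third_point D_add line_facts)
    interpret u: binary_cubic_line F D u u'
      using u_mem by unfold_locales auto
    have L: "u.line = line" using S by auto
    have su: "D (u + u') v \<longleftrightarrow> (D u v \<noteq> D u' v)" for v
      using u sum[of v] by (auto simp: third_point add.commute[of s r])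
    have "\<exists>g. \<not> D u g \<and> D u' g"
      using u ex[of False True] ex[of True False] ex[of True True] sum by auto
    then obtain g where g: "\<not> D u g" "D u' g" by blast
    have "\<not> D u' w" if "w \<in> line" for w
      using u.D_line_mem[of w u'] that u_mem u.line_facts L by blast
    then have "g \<notin> line" using g by blast
    then have Dgu: "D g u" using not_eckardt[of u u' g] u_mem g su by blast
    have kerL: "v \<in> u.line" if "\<not> D u v" "\<not> D u' v" for v
      unfolding L using ker[of v] that u by auto
    have g3: "D (u + u') g" using su g by blast
    obtain f where f: "f \<in> {u', u + u'}" "spans u f"
      "\<And>v. \<not> F v \<Longrightarrow> \<not> D u v \<Longrightarrow> D u' v \<Longrightarrow> spans u v"
      by (rule u.smooth_conic_step[OF kerL g g3 Dgu]) (assumption, assumption, erule that, assumption, blast)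
    have "f \<in> {r, s, r + s}" using f(1) S by blast
    moreover have "f \<noteq> u" using f(1) u_mem by auto
    moreover have "spans u v" if "\<not> F v" "\<not> D u v" "v \<notin> line" for v
      using f(3)[of v] ker[of v] that u by auto
    ultimately show ?thesis using f(2) by blast
  qed
  obtain P where P: "P \<in> {r, s, r + s}" "\<And>u. u \<in> {r, s, r + s} \<Longrightarrow> spans P u"
  proof -
    have "\<forall>u \<in> {r, s, r + s}. \<exists>f. f \<in> {r, s, r + s} \<and> f \<noteq> u \<and> spans u f"
      using step[of r s] step[of s r] step[of "r + s" r] by blast
    from bchoice[OF this] obtain f where
      f: "\<forall>u \<in> {r, s, r + s}. f u \<in> {r, s, r + s} \<and> f u \<noteq> u \<and> spans u (f u)" by blast
    \<comment> \<open>A map without fixed points on three points is a 3-cycle, or a 2-cycle with a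
      tail, in which case \<open>P\<close> is the tail.\<close>
    have "\<exists>P \<in> {r, s, r + s}. {r, s, r + s} \<subseteq> {P, f P, f (f P)}"
      using f third_point(1-3) by (smt (verit, best) insert_iff empty_iff subsetI)
    then obtain P where P: "P \<in> {r, s, r + s}" "{r, s, r + s} \<subseteq> {P, f P, f (f P)}" by blast
    then have "spans P (f P)" "spans (f P) (f (f P))" using f by blast+
    then have "spans P u" if "u \<in> {P, f P, f (f P)}" for u
      using that spans_refl spans_trans[of P "f P" "f (f P)"] by auto
    then show ?thesis using that P by blast
  qed
  have "spans P v" if v: "\<not> F v" "v \<noteq> 0" for v
  proof (cases "v \<in> line")
    case True
    then show ?thesis using P(2) v by auto
  next
    case False
    obtain u u' where u: "(u, u') \<in> {(r, s), (s, r), (r + s, r)}" "\<not> D u v"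
      using sum[of v] by blast
    then have "spans u v" using step[OF u(1)] v False by blast
    moreover have "spans P u" using P(2) u(1) by auto
    ultimately show ?thesis using spans_trans by blast
  qed
  then show ?thesis using that P(1) by blast
qed

text \<open>If \<open>r + s\<close> shares its tangent plane with \<open>u\<close>, the line is
  relabelled with base points \<open>u\<close> and \<open>r + s\<close> before
  \<open>folded_line_spans\<close> is applied.\<close>

theorem line_point_spans:
  obtains P where "P \<in> {r, s, r + s}" "\<And>v. \<not> F v \<Longrightarrow> v \<noteq> 0 \<Longrightarrow> spans P v"
proof -
  have rel: "eckardt_free_line F D u (r + s) d e" "{u, r + s, u + (r + s)} = {r, s, r + s}"
    if u: "u = r \<or> u = s" for u
  proof -
    from u show S: "{u, r + s, u + (r + s)} = {r, s, r + s}"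
      by (elim disjE) (simp_all only: third_point, blast+)
    then have L: "{0, u, r + s, u + (r + s)} = line" by auto
    show "eckardt_free_line F D u (r + s) d e"
    proof (unfold_locales, unfold L)
      show "\<not> F u" "\<not> F (r + s)" "\<not> D (r + s) u" "u \<noteq> 0" using u line_facts r_nz s_nz by auto
      show "\<not> D u (r + s)" using u line_facts by (auto simp: D_add)
      show "r + s \<noteq> 0" by (rule third_point)
      show "u \<noteq> r + s" using u third_point by metis
      show "v \<in> line \<or> v + d \<in> line \<or> v + e \<in> line \<or> v + (d + e) \<in> line" for v by (rule span)
      show "\<not> F u \<Longrightarrow> u \<noteq> 0 \<Longrightarrow> \<exists>v. D u v" for u by (rule smooth)
      show "\<exists>v. D u v \<noteq> D (r + s) v \<or> D (r + s) v \<noteq> D (u + (r + s)) v"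
        using u not_const by (elim disjE) (simp_all only: third_point, blast+)
    qed (rule not_eckardt)
  qed
  consider "\<And>v. D s v = D r v" | u where "u = r \<or> u = s" "\<And>v. D (r + s) v = D u v"
    | "\<exists>v. D r v \<noteq> D s v" "\<exists>v. D r v \<noteq> D (r + s) v" "\<exists>v. D s v \<noteq> D (r + s) v"
    by blast
  then show ?thesis
  proof cases
    case 1
    then show ?thesis using folded_line_spans that by blast
  next
    case 2
    interpret u: eckardt_free_line F D u "r + s" d e by (rule rel(1)[OF 2(1)])
    show ?thesis using u.folded_line_spans[OF 2(2)] rel(2)[OF 2(1)] that by metis
  next
    case 3
    then show ?thesis using smooth_conics_span that by blast
  qed
qed

end

section \<open>Polarization of cubic forms\<close>

definition mono4 :: "nat \<Rightarrow> nat \<Rightarrow> nat \<Rightarrow> nat \<Rightarrow> nat^4" where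
  "mono4 i j k l = (\<chi> n. if n = 1 then i else if n = 2 then j else if n = 3 then k else l)"

lemma mono4_nth [simp]:
  "mono4 i j k l $ 1 = i" "mono4 i j k l $ 2 = j" "mono4 i j k l $ 3 = k" "mono4 i j k l $ 4 = l"
  by (simp_all add: mono4_def)

lemma mono4_eq_iff: "e = mono4 i j k l \<longleftrightarrow> e $ 1 = i \<and> e $ 2 = j \<and> e $ 3 = k \<and> e $ 4 = l"
  by (simp add: vec_eq_iff forall_4)

lemma prod_4: "prod f (UNIV::4 set) = f 1 * f 2 * f 3 * f 4"
  unfolding UNIV_4 by (simp add: ac_simps)

lemma degmons_eq:
  "degmons d = (\<lambda>(i, j, k). mono4 i j k (d - i - j - k)) `
     (SIGMA i:{..d}. SIGMA j:{..d - i}. {..d - i - j})" (is "_ = ?m ` ?I")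
proof (intro equalityI subsetI)
  fix e assume "e \<in> degmons d"
  then have "e $ 1 + e $ 2 + e $ 3 + e $ 4 = d" by (simp add: degmons_def sum_4)
  then have "e = ?m (e $ 1, e $ 2, e $ 3)" "(e $ 1, e $ 2, e $ 3) \<in> ?I"
    by (auto simp: mono4_eq_iff)
  then show "e \<in> ?m ` ?I" by (rule image_eqI)
qed (auto simp: degmons_def sum_4)

text \<open>Nested ranges of exponents allow a form of fixed degree to be expanded by
  simplification.\<close>

lemma form_eval_eq_sum:
  "form_eval d c x = (\<Sum>i\<le>d. \<Sum>j\<le>d - i. \<Sum>k\<le>d - i - j.
     c (mono4 i j k (d - i - j - k)) * (x $ 1 ^ i * x $ 2 ^ j * x $ 3 ^ k * x $ 4 ^ (d - i - j - k)))"
proof -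
  have "inj_on (\<lambda>(i, j, k). mono4 i j k (d - i - j - k)) A" for A
    by (auto simp: inj_on_def mono4_eq_iff)
  then show ?thesis
    unfolding form_eval_def degmons_eq by (simp add: sum.reindex sum.Sigma prod_4 split_def)
qed

lemma dcoef_mono4:
  "dcoef c 1 (mono4 i j k l) = of_nat (i + 1) * c (mono4 (i + 1) j k l)"
  "dcoef c 2 (mono4 i j k l) = of_nat (j + 1) * c (mono4 i (j + 1) k l)"
  "dcoef c 3 (mono4 i j k l) = of_nat (k + 1) * c (mono4 i j (k + 1) l)"
  "dcoef c 4 (mono4 i j k l) = of_nat (l + 1) * c (mono4 i j k (l + 1))"
proof -
  have "(\<chi> n. if n = 1 then mono4 i j k l $ n + 1 else mono4 i j k l $ n) = mono4 (i + 1) j k l"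
    "(\<chi> n. if n = 2 then mono4 i j k l $ n + 1 else mono4 i j k l $ n) = mono4 i (j + 1) k l"
    "(\<chi> n. if n = 3 then mono4 i j k l $ n + 1 else mono4 i j k l $ n) = mono4 i j (k + 1) l"
    "(\<chi> n. if n = 4 then mono4 i j k l $ n + 1 else mono4 i j k l $ n) = mono4 i j k (l + 1)"
    by (simp_all add: mono4_eq_iff)
  then show "dcoef c 1 (mono4 i j k l) = of_nat (i + 1) * c (mono4 (i + 1) j k l)"
    "dcoef c 2 (mono4 i j k l) = of_nat (j + 1) * c (mono4 i (j + 1) k l)"
    "dcoef c 3 (mono4 i j k l) = of_nat (k + 1) * c (mono4 i j (k + 1) l)"
    "dcoef c 4 (mono4 i j k l) = of_nat (l + 1) * c (mono4 i j k (l + 1))"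
    by (simp_all add: dcoef_def)
qed

text \<open>The differential of the cubic at \<open>u\<close>, applied to \<open>v\<close>, in terms
  of formal partial derivatives; over F_2 it becomes \<open>D u v\<close>.\<close>

definition polar :: "(nat^4 \<Rightarrow> 'a::comm_ring_1) \<Rightarrow> 'a^4 \<Rightarrow> 'a^4 \<Rightarrow> 'a" where
  "polar c u v = (\<Sum>i\<in>UNIV. v $ i * form_eval 2 (dcoef c i) u)"

lemmas cubic_expand = form_eval_eq_sum polar_def sum_4 dcoef_mono4 eval_nat_numeral

lemma polar_add_right: "polar c u (v + w) = polar c u v + polar c u w"
  by (simp add: polar_def sum.distrib ring_distribs)

lemma polar_scale_right: "polar c u (x *s v) = x * polar c u v"
  by (simp add: polar_def sum_distrib_left mult.assoc)

lemma form_eval_2_line: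
  "form_eval 2 c (x *s u + y *s v) = x^2 * form_eval 2 c u
     + x * y * (form_eval 2 c (u + v) - form_eval 2 c u - form_eval 2 c v) + y^2 * form_eval 2 c v"
  unfolding form_eval_eq_sum eval_nat_numeral
  by simp (simp add: algebra_simps)

lemma polar_line_left:
  "polar c (x *s u + y *s v) w = x^2 * polar c u w
     + x * y * (polar c (u + v) w - polar c u w - polar c v w) + y^2 * polar c v w"
  unfolding polar_def sum_4 form_eval_2_line by (simp add: algebra_simps)

text \<open>This Taylor expansion has no denominators, so it holds in characteristic 2.\<close>

lemma cubic_line:
  "form_eval 3 c (x *s u + y *s v) = x^3 * form_eval 3 c u + x^2 * y * polar c u v
     + x * y^2 * polar c v u + y^3 * form_eval 3 c v"
  unfolding cubic_expand by simp (simp add: algebra_simps)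

lemma euler_cubic: "polar c u u = 3 * form_eval 3 c u"
  unfolding cubic_expand
  by (simp add: dcoef_mono4 algebra_simps)

section \<open>Descent from the algebraic closure\<close>

lemma bit_add_eq_1_iff: "x + y = (1::bit) \<longleftrightarrow> (x = 1) \<noteq> (y = 1)"
  by (cases x; cases y) simp_all

lemma bit_vec_add_self: "x + x = (0::bit^'n)"
  by (simp add: vec_eq_iff flip: mult_2)

lemma to_ac_o_dcoef: "dcoef (to_ac \<circ> c) i = to_ac \<circ> dcoef c i"
  by (simp add: dcoef_def fun_eq_iff)

lemma form_eval_to_ac:
  fixes c :: "nat^4 \<Rightarrow> 'a::field"
  shows "form_eval n (to_ac \<circ> c) (\<chi> i. to_ac (v $ i)) = to_ac (form_eval n c v)"
  by (simp add: form_eval_def to_ac_sum to_ac_prod)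

lemma form_eval_vec_bar: "form_eval n (to_ac \<circ> c) (vec_bar v) = to_ac (form_eval n c v)"
  unfolding vec_bar_def by (rule form_eval_to_ac)

lemma polar_vec_bar: "polar (to_ac \<circ> c) (vec_bar u) (vec_bar v) = to_ac (polar c u v)"
  unfolding polar_def to_ac_o_dcoef form_eval_vec_bar to_ac_sum to_ac_mult by (simp add: vec_bar_def)

lemma vec_bar_add: "vec_bar (u + v) = vec_bar u + vec_bar v"
  unfolding vec_bar_def vec_eq_iff by (simp only: vec_lambda_beta vector_add_component to_ac_add simp_thms)

lemma Kbar_add_self: "x + x = (0::Kbar)"
proof -
  have "(2::Kbar) = to_ac 2" by (rule to_ac_numeral[symmetric])
  then show ?thesis by (simp flip: mult_2)
qed

lemma Kbar_add_self_left: "x + (x + y) = (y::Kbar)"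
  by (simp add: Kbar_add_self flip: add.assoc)

lemma Kbar_add_eq_0_iff: "x + y = 0 \<longleftrightarrow> x = (y::Kbar)"
  by (metis Kbar_add_self add_left_cancel)

lemma Kbar_minus: "- x = (x::Kbar)"
  by (metis Kbar_add_self minus_unique)

lemma Kbar_diff: "x - y = x + (y::Kbar)"
  by (metis Kbar_minus diff_conv_add_uminus)

lemma Kbar_omega:
  obtains \<omega> :: Kbar where "\<omega>\<^sup>2 + \<omega> + 1 = 0"
proof -
  have "\<exists>x::Kbar. (\<Sum>k\<le>2. 1 * x ^ k) = 0"
    by (rule alg_closed[where f = "\<lambda>_. 1"]) simp_all
  then obtain x :: Kbar where "(\<Sum>k\<le>2. 1 * x ^ k) = 0" by blast
  then have "x\<^sup>2 + x + 1 = 0" by (simp add: numeral_2_eq_2 algebra_simps)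
  then show ?thesis by (rule that)
qed

text \<open>If an outer coefficient is zero, a coordinate point is a root. Otherwise the form is x^2
  + w^2 or x^2 + x w + w^2, with root (1, 1) or a primitive cube root of unity.\<close>

lemma binary_quadratic_root:
  fixes \<alpha> \<mu> \<gamma> :: bit
  obtains x w :: Kbar where "(x, w) \<noteq> (0, 0)" "x\<^sup>2 * to_ac \<alpha> + x * w * to_ac \<mu> + w\<^sup>2 * to_ac \<gamma> = 0"
proof (cases "\<alpha> = 1 \<and> \<gamma> = 1")
  case False
  then show ?thesis using that[of 1 0] that[of 0 1] by auto
next
  case True
  obtain \<omega> :: Kbar where "\<omega>\<^sup>2 + \<omega> + 1 = 0" by (rule Kbar_omega)
  then show ?thesis using that[of \<omega> 1] that[of 1 1] True Kbar_add_self[of 1] by (cases \<mu>) auto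
qed

lemma split_quadratic:
  fixes \<phi> :: bit
  obtains x :: Kbar where "x\<^sup>2 + x + to_ac \<phi> = 0"
proof (cases "\<phi> = 0")
  case False
  obtain \<omega> :: Kbar where "\<omega>\<^sup>2 + \<omega> + 1 = 0" by (rule Kbar_omega)
  then show ?thesis using that False by simp
qed (use that[of 0] in simp)

text \<open>Each of the seven nonzero combinations of the three vectors has a coordinate equal to 1.
  Hence the triples of coordinates do not all lie in one hyperplane of the three-dimensional space
  over F_2; \<open>s1\<close> to \<open>s7\<close> record this, one hyperplane each.\<close>

lemma vec_bar_independent:
  fixes u u' v :: "K^4"
  assumes indep: "u \<noteq> 0" "u' \<noteq> 0" "u \<noteq> u'" "v \<notin> {0, u, u', u + u'}"
    and eq: "s *s vec_bar u + t *s vec_bar u' + w *s vec_bar v = 0"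
  shows "s = 0 \<and> t = 0 \<and> w = 0"
proof -
  have eq_k: "s * to_ac (u $ k) + t * to_ac (u' $ k) + w * to_ac (v $ k) = 0" for k
    using eq by (simp add: vec_eq_iff vec_bar_def)
  have nz: "\<exists>k. z $ k = 1" if "z \<noteq> 0" for z :: "K^4"
    using that by (auto simp: vec_eq_iff)
  have add_0: "x + y = 0 \<longleftrightarrow> x = y" for x y :: "K^4"
    using bit_vec_add_self[of x] by (metis add_left_cancel)
  have "u + u' \<noteq> 0" "u + v \<noteq> 0" "u' + v \<noteq> 0" "v \<noteq> 0" "u + u' + v \<noteq> 0"
    using indep by (auto simp: add_0)
  note ex = nz[OF indep(1)] nz[OF indep(2)] this[THEN nz]
  have s1: "s = 0 \<or> s + t = 0 \<or> s + w = 0 \<or> s + t + w = 0"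
  proof -
    obtain k where "u $ k = 1" using ex by blast
    then show ?thesis using eq_k[of k] by (cases "u' $ k"; cases "v $ k") auto
  qed
  have s2: "t = 0 \<or> s + t = 0 \<or> t + w = 0 \<or> s + t + w = 0"
  proof -
    obtain k where "u' $ k = 1" using ex by blast
    then show ?thesis using eq_k[of k] by (cases "u $ k"; cases "v $ k") auto
  qed
  have s3: "w = 0 \<or> s + w = 0 \<or> t + w = 0 \<or> s + t + w = 0"
  proof -
    obtain k where "v $ k = 1" using ex by blast
    then show ?thesis using eq_k[of k] by (cases "u' $ k"; cases "u $ k") auto
  qed
  have s4: "s = 0 \<or> t = 0 \<or> s + w = 0 \<or> t + w = 0"
  proof -
    obtain k where "(u + u') $ k = 1" using ex by blast
    then show ?thesis using eq_k[of k] by (cases "u' $ k"; cases "u $ k"; cases "v $ k") auto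
  qed
  have s5: "s = 0 \<or> w = 0 \<or> s + t = 0 \<or> t + w = 0"
  proof -
    obtain k where "(u + v) $ k = 1" using ex by blast
    then show ?thesis using eq_k[of k] by (cases "u' $ k"; cases "u $ k"; cases "v $ k") auto
  qed
  have s6: "t = 0 \<or> w = 0 \<or> s + t = 0 \<or> s + w = 0"
  proof -
    obtain k where "(u' + v) $ k = 1" using ex by blast
    then show ?thesis using eq_k[of k] by (cases "u' $ k"; cases "u $ k"; cases "v $ k") auto
  qed
  have s7: "s = 0 \<or> t = 0 \<or> w = 0 \<or> s + t + w = 0"
  proof -
    obtain k where "(u + u' + v) $ k = 1" using ex by blast
    then show ?thesis using eq_k[of k] by (cases "u' $ k"; cases "u $ k"; cases "v $ k") auto
  qed
  have e: "s + t = 0 \<longleftrightarrow> t = s" "s + w = 0 \<longleftrightarrow> w = s" "t + w = 0 \<longleftrightarrow> w = t" "s + t + w = 0 \<longleftrightarrow> w = s + t"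
    by (auto simp: Kbar_add_eq_0_iff)
  have cl: "w = s + t \<Longrightarrow> w = s \<Longrightarrow> t = 0" "w = s + t \<Longrightarrow> w = t \<Longrightarrow> s = 0" "w = s + t \<Longrightarrow> t = s \<Longrightarrow> w = 0"
    by (auto simp: Kbar_add_self)
  show ?thesis
  proof (cases "s = 0")
    case True
    then show ?thesis using s2 s3 s6 unfolding e by auto
  next
    case s: False
    have "t \<noteq> 0"
    proof
      assume "t = 0"
      then have "w = s" using s1 s unfolding e by auto
      then show False using s5 s \<open>t = 0\<close> unfolding e by auto
    qed
    moreover have "w \<noteq> 0" using s4 s calculation unfolding e by auto
    ultimately show ?thesis using s4 s7 s cl unfolding e by metis
  qed
qed

text \<open>The cosets of 0 and \<open>v\<close> fill at most 8 of the 16 vectors, so some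
  \<open>z\<close> is left, and the four resulting cosets exhaust the space by counting.\<close>

lemma bit_coset_reps:
  fixes L :: "(K^4) set"
  assumes L_add: "\<And>x y. x \<in> L \<Longrightarrow> y \<in> L \<Longrightarrow> x + y \<in> L" and L_card: "card L = 4" and v: "v \<notin> L"
  obtains z where "\<And>x. x \<in> L \<or> x + v \<in> L \<or> x + z \<in> L \<or> x + (v + z) \<in> L"
proof -
  have add_self_left: "x + (x + y) = y" for x y :: "K^4"
    using bit_vec_add_self[of x] by (simp flip: add.assoc)
  note ac = bit_vec_add_self add_self_left add.assoc add.commute add.left_commute
  have add_0: "x + y = 0 \<longleftrightarrow> x = y" for x y :: "K^4"
    using bit_vec_add_self[of x] by (metis add_left_cancel)
  have "L \<noteq> {}" using L_card by auto
  then have L_0: "0 \<in> L" using L_add bit_vec_add_self by (metis all_not_in_conv)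
  have "(UNIV :: bit set) = {0, 1}" using bit_not_one_iff by blast
  then have "CARD(bit) = 2" by (metis card_2_iff zero_neq_one)
  then have card_K4: "CARD(K^4) = 16" by simp
  then have fin: "finite (UNIV :: (K^4) set)" by (metis card.infinite zero_neq_numeral)
  have finL: "finite L" using L_card card.infinite by fastforce
  then have "card (L \<union> (+) v ` L) \<le> 4 + 4"
    using card_Un_le[of L "(+) v ` L"] card_image_le[OF finL, of "(+) v"] L_card by linarith
  then have "L \<union> (+) v ` L \<noteq> UNIV" using card_K4 by auto
  then obtain z where "z \<notin> L \<union> (+) v ` L" by blast
  then have z: "z \<notin> L" "z \<notin> (+) v ` L" by blast+
  have vz: "v + z \<notin> L" using z add_self_left by (metis imageI)
  have ne: "z \<noteq> 0" "v \<noteq> 0" "v \<noteq> z" using z v L_0 vz bit_vec_add_self by metis+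
  let ?G = "{0, v, z, v + z}"
  have card_G: "card ?G = 4" using ne by (auto simp: card_insert_if add_0)
  have G: "g = g'" if "g \<in> ?G" "g' \<in> ?G" "g + g' \<in> L" for g g'
  proof -
    have "g + g' \<in> ?G" using that(1,2) by (elim insertE emptyE) (simp_all add: ac)
    then have "g + g' = 0" using that(3) z vz v by (elim insertE emptyE) (simp_all only: simp_thms)
    then show ?thesis by (simp add: add_0)
  qed
  have inj: "inj_on (\<lambda>p. fst p + snd p) (L \<times> ?G)"
  proof (rule inj_onI)
    fix p p' :: "(K^4) \<times> (K^4)"
    assume p: "p \<in> (L \<times> ?G)" "p' \<in> (L \<times> ?G)"
      and eq: "fst p + snd p = fst p' + snd p'"
    have "snd p + snd p' = fst p + (fst p + snd p) + snd p'" by (simp add: add_self_left)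
    also have "\<dots> = fst p + (fst p' + snd p') + snd p'" by (simp only: eq)
    also have "\<dots> = fst p + fst p'" by (simp add: add.assoc bit_vec_add_self)
    finally have "snd p + snd p' \<in> L" using p L_add unfolding mem_Times_iff by metis
    then have "snd p = snd p'" using p G unfolding mem_Times_iff by blast
    then show "p = p'" using eq by (simp add: prod_eq_iff)
  qed
  have card_LG: "card (L \<times> ?G) = 16"
    unfolding card_cartesian_product card_G L_card by simp
  have img: "(\<lambda>p. fst p + snd p) ` (L \<times> ?G) = UNIV"
    by (rule card_subset_eq[OF fin subset_UNIV]) (simp only: card_image[OF inj] card_LG card_K4)
  have "\<exists>g \<in> ?G. x + g \<in> L" for x
  proof -
    have "x \<in> (\<lambda>p. fst p + snd p) ` (L \<times> ?G)" unfolding img by (rule UNIV_I)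
    then obtain y where y: "y \<in> L \<times> ?G" "x = fst y + snd y" by (elim imageE)
    then have "x + snd y = fst y" by (simp only: add.assoc bit_vec_add_self add_0_right)
    then show ?thesis using y(1) unfolding mem_Times_iff by metis
  qed
  then show ?thesis using that[of z] by simp
qed

section \<open>The cubic over F_2 and its values on lines over the closure\<close>

abbreviation "nonzero_at c v \<equiv> form_eval 3 c v = (1::K)"
abbreviation "transversal c u v \<equiv> polar c u v = (1::K)"

lemma bit_eqI: "(x = 1 \<longleftrightarrow> y = 1) \<Longrightarrow> x = (y::bit)"
  by (cases x; cases y) simp_all

lemma bit_add_eq_0_iff: "x + y = 0 \<longleftrightarrow> x = (y::bit)"
  by (cases x; cases y) simp_all

lemma binary_cubic_form: "binary_cubic (nonzero_at c) (transversal c)"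
proof
  fix u v w :: "K^4"
  show "u + u = 0" by (rule bit_vec_add_self)
  show "transversal c u (v + w) \<longleftrightarrow> transversal c u v \<noteq> transversal c u w"
    by (simp only: polar_add_right bit_add_eq_1_iff)
  show "nonzero_at c (u + v) \<longleftrightarrow> nonzero_at c u \<noteq> (nonzero_at c v \<noteq> (transversal c u v \<noteq> transversal c v u))"
    using cubic_line[of c 1 u 1 v]
    by (simp only: power_one mult_1 vector_smult_lid bit_add_eq_1_iff) blast
  have "(3::bit) = 1" by simp
  then show "transversal c u u \<longleftrightarrow> nonzero_at c u"
    by (simp only: euler_cubic mult_1)
qed

lemma bar_line:
  "form_eval 3 (to_ac \<circ> c) (x *s vec_bar u + y *s vec_bar v) =
     x^3 * to_ac (form_eval 3 c u) + x^2 * y * to_ac (polar c u v)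
     + x * y^2 * to_ac (polar c v u) + y^3 * to_ac (form_eval 3 c v)"
  unfolding cubic_line polar_vec_bar form_eval_vec_bar ..

lemma bar_polar_line:
  "polar (to_ac \<circ> c) (x *s vec_bar u + y *s vec_bar v) (vec_bar w) = x^2 * to_ac (polar c u w)
     + x * y * (to_ac (polar c (u + v) w) + to_ac (polar c u w) + to_ac (polar c v w)) + y^2 * to_ac (polar c v w)"
  unfolding polar_line_left[of _ x _ y] vec_bar_add[symmetric] polar_vec_bar Kbar_diff ..

text \<open>The partial derivatives are the values of the differential on unit vectors, so rational
  directions detect smoothness even at points of the closure.\<close>

lemma smooth_cubicD:
  assumes "smooth_cubic c" "x \<noteq> 0" "form_eval 3 (to_ac \<circ> c) x = 0"
  obtains v where "polar (to_ac \<circ> c) x (vec_bar v) \<noteq> 0"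
proof -
  obtain i where i: "form_eval 2 (dcoef (to_ac \<circ> c) i) x \<noteq> 0"
    using assms unfolding smooth_cubic_def cubic_bar_def by blast
  have "vec_bar (axis i 1) = axis i 1"
    unfolding vec_bar_def axis_def vec_eq_iff by (auto simp only: vec_lambda_beta to_ac_0 to_ac_1 split: if_splits)
  then have "polar (to_ac \<circ> c) x (vec_bar (axis i 1)) = form_eval 2 (dcoef (to_ac \<circ> c) i) x"
    by (simp add: polar_def axis_def if_distrib[of "\<lambda>y. y * _"] cong: if_cong)
  then show ?thesis using i that[of "axis i 1"] by simp
qed

lemma smooth_cubic_rational:
  assumes "smooth_cubic c" "u \<noteq> 0" "form_eval 3 c u \<noteq> 1"
  obtains v where "polar c u v = 1"
proof -
  have nz: "vec_bar u \<noteq> 0" using assms(2) by (simp add: vec_bar_def vec_eq_iff)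
  have "form_eval 3 (to_ac \<circ> c) (vec_bar u) = 0"
    using assms(3) by (simp add: form_eval_vec_bar)
  with smooth_cubicD[OF assms(1) nz] obtain v where "polar (to_ac \<circ> c) (vec_bar u) (vec_bar v) \<noteq> 0" by blast
  then show ?thesis using that by (simp add: polar_vec_bar)
qed

section \<open>Spans of rational points as stable sets\<close>

lemma span_step_bounds: "B \<subseteq> rat_points c \<Longrightarrow> B \<subseteq> span_step c B \<and> span_step c B \<subseteq> rat_points c"
  unfolding span_step_def by blast

lemma span_iterate_bounds:
  assumes "B \<subseteq> rat_points c"
  shows "(span_step c ^^ n) B \<subseteq> rat_points c"
  using assms span_step_bounds by (induction n) auto

lemma span_iterate_mono:
  assumes "B \<subseteq> rat_points c" "m \<le> n"
  shows "(span_step c ^^ m) B \<subseteq> (span_step c ^^ n) B"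
  using assms(2)
proof (induction rule: dec_induct)
  case (step n)
  then show ?case using span_step_bounds[OF span_iterate_bounds[OF assms(1)]] by fastforce
qed simp

lemma Span_subset: "B \<subseteq> rat_points c \<Longrightarrow> Span c B \<subseteq> rat_points c"
  unfolding Span_def using span_iterate_bounds by blast

lemma Span_closed:
  assumes B: "B \<subseteq> rat_points c" and PQ: "P \<in> Span c B" "Q \<in> Span c B"
    and R: "R \<in> rat_points c" "meets3 c a b P Q R"
  shows "R \<in> Span c B"
proof -
  obtain m n where mn: "P \<in> (span_step c ^^ m) B" "Q \<in> (span_step c ^^ n) B"
    using PQ unfolding Span_def by blast
  then have "P \<in> (span_step c ^^ max m n) B" "Q \<in> (span_step c ^^ max m n) B"
    using span_iterate_mono[OF B max.cobounded1] span_iterate_mono[OF B max.cobounded2] by blast+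
  then have "R \<in> span_step c ((span_step c ^^ max m n) B)"
    using R unfolding span_step_def by blast
  then have "R \<in> (span_step c ^^ Suc (max m n)) B" by simp
  then show ?thesis unfolding Span_def by blast
qed

lemma indep2_bit:
  assumes "u \<noteq> 0" "v \<noteq> 0" "u \<noteq> (v :: K^4)"
  shows "indep2 u v"
proof -
  have "u + v \<noteq> 0" using assms(3) bit_vec_add_self[of u] by (metis add_left_cancel)
  then have "s = 0 \<and> t = 0" if "s *s u + t *s v = 0" for s t
    using that assms by (cases s; cases t) auto
  then show ?thesis unfolding indep2_def by blast
qed

lemma meets3_tangent:
  assumes "u \<noteq> 0" "v \<noteq> 0" "u \<noteq> v" "form_eval 3 c u = 0" "form_eval 3 c v = 0"
    "polar c u v = 0" "polar c v u = 1"
  shows "meets3 c u v u u v"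
proof -
  have eq: "cubic_bar c (s *s vec_bar u + t *s vec_bar v) = s * t^2" for s t
    by (simp add: cubic_bar_def bar_line assms)
  have "(1::Kbar) * 1\<^sup>2 \<noteq> 0" by simp
  then have nz: "\<not> (\<forall>s t :: Kbar. s * t^2 = 0)" by blast
  show ?thesis
    unfolding meets3_def eq
  proof (intro conjI exI)
    show "indep2 u v" using assms indep2_bit by blast
    show "u = 1 *s u + 0 *s v" "u = 1 *s u + 0 *s v" "v = 0 *s u + 1 *s v" by simp_all
    show "\<forall>s t :: Kbar. s * t^2 = to_ac 1 * (to_ac 0 * s - to_ac 1 * t) * (to_ac 0 * s - to_ac 1 * t)
                     * (to_ac 1 * s - to_ac 0 * t)"
      by (simp add: power2_eq_square)
  qed (use assms nz in auto)
qed

lemma meets3_secant: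
  assumes "u \<noteq> 0" "v \<noteq> 0" "u \<noteq> v" "form_eval 3 c u = 0" "form_eval 3 c v = 0"
    "polar c u v = 1" "polar c v u = 1"
  shows "meets3 c u v u v (u + v)"
proof -
  have eq: "cubic_bar c (s *s vec_bar u + t *s vec_bar v) = s^2 * t + s * t^2" for s t
    by (simp add: cubic_bar_def bar_line assms)
  \<comment> \<open>The polynomial s^2 t + s t^2 vanishes at all pairs from F_2, so a point over a
    larger field must show that it is not zero.\<close>
  obtain \<omega> :: Kbar where "\<omega>\<^sup>2 + \<omega> + 1 = 0" by (rule Kbar_omega)
  then have "\<omega>\<^sup>2 * 1 + \<omega> * 1\<^sup>2 \<noteq> 0" by auto
  then have nz: "\<not> (\<forall>s t :: Kbar. s^2 * t + s * t^2 = 0)" by blast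
  show ?thesis
    unfolding meets3_def eq
  proof (intro conjI exI)
    show "indep2 u v" using assms indep2_bit by blast
    show "u = 1 *s u + 0 *s v" "v = 0 *s u + 1 *s v" "u + v = 1 *s u + 1 *s v" by simp_all
    show "\<forall>s t :: Kbar. s^2 * t + s * t^2 = to_ac 1 * (to_ac 0 * s - to_ac 1 * t) * (to_ac 1 * s - to_ac 0 * t)
                     * (to_ac 1 * s - to_ac 1 * t)"
      by (simp add: power2_eq_square algebra_simps Kbar_diff Kbar_minus)
    show "u + v \<noteq> 0" using assms(3) bit_vec_add_self[of u] by (metis add_left_cancel)
  qed (use assms nz in auto)
qed

lemma Span_stable:
  assumes B: "B \<subseteq> rat_points c"
  shows "binary_cubic.stable (nonzero_at c) (transversal c) (Span c B)"
proof -
  interpret binary_cubic "nonzero_at c" "transversal c" by (rule binary_cubic_form)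
  show ?thesis
    unfolding stable_def
  proof (intro conjI ballI allI impI)
    fix u v
    assume u: "u \<in> Span c B" and h: "\<not> nonzero_at c v" "\<not> transversal c u v" "nonzero_at c (u + v)"
    have u': "u \<noteq> 0" "\<not> nonzero_at c u" using u Span_subset[OF B] by (auto simp: rat_points_def)
    have "transversal c v u" using F_add[of u v] u' h by blast
    moreover have "v \<noteq> 0" "u \<noteq> v" using u' h F_0 add_self by auto
    ultimately show "v \<in> Span c B"
      using Span_closed[OF B u u _ meets3_tangent] u' h by (simp add: rat_points_def)
  next
    fix u v
    assume u: "u \<in> Span c B" and v: "v \<in> Span c B" and h: "transversal c u v" "\<not> nonzero_at c (u + v)"
    have u': "u \<noteq> 0" "\<not> nonzero_at c u" "v \<noteq> 0" "\<not> nonzero_at c v"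
      using u v Span_subset[OF B] by (auto simp: rat_points_def)
    have "transversal c v u" using F_add[of u v] u' h by blast
    moreover have ne: "u \<noteq> v" using u' h D_self by blast
    ultimately show "u + v \<in> Span c B"
      using Span_closed[OF B u v _ meets3_secant] u' h by (simp add: rat_points_def add_eq_0_iff)
  qed
qed

section \<open>Lines, singular points and Eckardt points over the closure\<close>

lemma line_on_rational:
  assumes "line_on c (vec_bar a) (vec_bar b)"
  shows "form_eval 3 c a = 0" "form_eval 3 c b = 0" "polar c a b = 0" "polar c b a = 0"
proof -
  have eq: "form_eval 3 (to_ac \<circ> c) (s *s vec_bar a + t *s vec_bar b) = 0" for s t
    using assms unfolding line_on_def lspan_def cubic_bar_def by blast
  show ab: "form_eval 3 c a = 0" "form_eval 3 c b = 0"
    using eq[of 1 0] eq[of 0 1] unfolding bar_line by simp_all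
  have "to_ac (polar c a b) + to_ac (polar c b a) = 0" using eq[of 1 1] ab unfolding bar_line by simp
  then have ab_eq: "polar c a b = polar c b a" by (simp only: Kbar_add_eq_0_iff to_ac_eq_iff)
  \<comment> \<open>Rational parameters only show that the two mixed coefficients agree; a cube root
    of unity makes them vanish.\<close>
  obtain \<omega> :: Kbar where w: "\<omega>\<^sup>2 + \<omega> + 1 = 0" by (rule Kbar_omega)
  have "\<omega>\<^sup>2 * to_ac (polar c b a) + \<omega> * to_ac (polar c b a) = 0"
    using eq[of \<omega> 1] ab ab_eq unfolding bar_line by simp
  then show "polar c b a = 0" using w by (cases "polar c b a") auto
  then show "polar c a b = 0" using ab_eq by simp
qed

lemma tangent_planes_not_const:
  assumes c: "smooth_cubic c" and l: "line_on c (vec_bar a) (vec_bar b)"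
  shows "\<exists>v. transversal c a v \<noteq> transversal c b v \<or> transversal c b v \<noteq> transversal c (a + b) v"
proof (rule ccontr)
  assume "\<not> ?thesis"
  then have const: "polar c a v = polar c b v" "polar c (a + b) v = polar c b v" for v
    by (intro bit_eqI, blast)+
  obtain \<omega> :: Kbar where w: "\<omega>\<^sup>2 + \<omega> + 1 = 0" by (rule Kbar_omega)
  let ?x = "1 *s vec_bar a + \<omega> *s vec_bar b"
  have nz: "?x \<noteq> 0" using l unfolding line_on_def indep2_def by (metis zero_neq_one)
  have "form_eval 3 (to_ac \<circ> c) ?x = 0" unfolding bar_line by (simp add: line_on_rational[OF l])
  then obtain v where v: "polar (to_ac \<circ> c) ?x (vec_bar v) \<noteq> 0" using smooth_cubicD[OF c nz] by blast
  have "polar (to_ac \<circ> c) ?x (vec_bar v) = to_ac (polar c b v) * (\<omega>\<^sup>2 + \<omega> + 1)"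
    unfolding bar_polar_line const by (simp add: Kbar_add_self algebra_simps)
  then show False using v w by simp
qed

text \<open>The plane through \<open>u\<close>, \<open>v\<close>, \<open>u'\<close> is tangent at
  \<open>u\<close>, \<open>v\<close> and \<open>u + v\<close>, hence along their whole line, so each
  differential there is determined by its value on one further vector \<open>z\<close>. That value
  is a binary quadratic form in the parameters, and at its root over the closure the surface would
  be singular.\<close>

lemma double_line_singular:
  assumes c: "smooth_cubic c"
    and indep: "u \<noteq> 0" "v \<noteq> 0" "u \<noteq> v" "u' \<notin> {0, u, v, u + v}"
    and S: "form_eval 3 c u = 0" "form_eval 3 c v = 0"
    and T: "\<And>y. y \<in> {u, v, u'} \<Longrightarrow> polar c u y = 0 \<and> polar c v y = 0 \<and> polar c (u + v) y = 0"
  shows False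
proof -
  interpret binary_cubic "nonzero_at c" "transversal c" by (rule binary_cubic_form)
  let ?L = "{0, u, v, u + v}"
  have "x + y \<in> ?L" if "x \<in> ?L" "y \<in> ?L" for x y
    using that by (elim insertE emptyE) (simp_all add: char2_simps)
  moreover have "card ?L = 4" using indep by (auto simp: card_insert_if add_eq_0_iff)
  ultimately obtain z where z: "\<And>x. x \<in> ?L \<or> x + u' \<in> ?L \<or> x + z \<in> ?L \<or> x + (u' + z) \<in> ?L"
    using bit_coset_reps[of ?L u'] indep(4) by metis
  \<comment> \<open>By \<open>bar_polar_line\<close> these three values determine the differential
    at every point of the line over the closure.\<close>
  define E where "E y = (polar c u y, polar c v y, polar c (u + v) y)" for y
  have E_add: "E (x + y) = E x + E y" for x y
    by (simp add: E_def polar_add_right)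
  have E_0: "E y = 0" if "y \<in> {u, v, u'}" for y
    using T[OF that] by (simp add: E_def zero_prod_def)
  have E_L: "E y = 0" if "y \<in> ?L" for y
    using that E_0 E_add[of 0 0] E_add[of u v] by auto
  have E_eq: "E x = E y" if "x + y \<in> ?L" for x y
  proof -
    have "E x + E y = 0" using E_L[OF that] E_add by simp
    then show ?thesis
      unfolding E_def zero_prod_def plus_prod_def fst_conv snd_conv prod.inject bit_add_eq_0_iff .
  qed
  have E_cases: "E y = 0 \<or> E y = E z" for y
    using z[of y] E_L[of y] E_eq[of y u'] E_eq[of y z] E_eq[of y "u' + z"] E_0[of u'] E_add[of u' z] by auto
  obtain x w :: Kbar where xw: "(x, w) \<noteq> (0, 0)"
    "x\<^sup>2 * to_ac (polar c u z) + x * w * to_ac (polar c (u + v) z + polar c u z + polar c v z)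
      + w\<^sup>2 * to_ac (polar c v z) = 0"
    by (rule binary_quadratic_root)
  let ?p = "x *s vec_bar u + w *s vec_bar v"
  have "?p \<noteq> 0" using vec_bar_independent[OF indep, of x w 0] xw(1) by auto
  moreover have "form_eval 3 (to_ac \<circ> c) ?p = 0"
    unfolding bar_line using T S by simp
  ultimately obtain y where y: "polar (to_ac \<circ> c) ?p (vec_bar y) \<noteq> 0"
    using smooth_cubicD[OF c] by blast
  have "polar (to_ac \<circ> c) ?p (vec_bar y) = 0"
  proof (cases "E y = 0")
    case True
    then show ?thesis unfolding bar_polar_line by (simp add: E_def zero_prod_def)
  next
    case False
    then have "E y = E z" using E_cases by blast
    then have "polar c u y = polar c u z" "polar c v y = polar c v z" "polar c (u + v) y = polar c (u + v) z"
      by (simp_all only: E_def prod.inject)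
    then show ?thesis unfolding bar_polar_line using xw(2) by (simp only: to_ac_add)
  qed
  then show False using y by simp
qed

text \<open>The form in the plane, computed in \<open>plane\<close>, has a conic factor free of x.
  If \<open>polar c v u'\<close> is 1, this conic splits into two lines through \<open>u\<close>,
  distinct because the roots differ by 1. If it is 0, the conic is a double line, which smoothness
  excludes.\<close>

lemma singular_conic_eckardt:
  assumes c: "smooth_cubic c"
    and indep: "u \<noteq> 0" "u' \<noteq> 0" "u \<noteq> u'" "v \<notin> {0, u, u', u + u'}"
    and l: "form_eval 3 c u = 0" "form_eval 3 c u' = 0" "polar c u u' = 0" "polar c u' u = 0"
    and t: "polar c u v = 0" "polar c u' v = 1" "polar c (u + u') v = 1" "polar c v u = 0"
  shows "eckardt c (vec_bar u)"
proof -
  interpret binary_cubic "nonzero_at c" "transversal c" by (rule binary_cubic_form)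
  let ?U = "vec_bar u" and ?U' = "vec_bar u'" and ?V = "vec_bar v"
  let ?F = "form_eval 3 (to_ac \<circ> c)"
  have plane: "?F (x *s ?U + y *s ?U' + w *s ?V) =
    w * (y\<^sup>2 + y * w * to_ac (polar c v u') + w\<^sup>2 * to_ac (form_eval 3 c v))" for x y w
  proof -
    have 1: "polar (to_ac \<circ> c) (x *s ?U + y *s ?U') ?V = y\<^sup>2"
      unfolding bar_polar_line t by (simp add: Kbar_add_self)
    have 2: "polar (to_ac \<circ> c) ?V (x *s ?U + y *s ?U') = y * to_ac (polar c v u')"
      unfolding polar_add_right polar_scale_right polar_vec_bar t by simp
    have 3: "?F (x *s ?U + y *s ?U') = 0" unfolding bar_line l by simp
    show ?thesis
      using cubic_line[of "to_ac \<circ> c" 1 "x *s ?U + y *s ?U'" w ?V]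
      unfolding 1 2 3 form_eval_vec_bar
      by (simp add: power2_eq_square power3_eq_cube algebra_simps)
  qed
  note ind = vec_bar_independent[OF indep]
  show ?thesis
  proof (cases "polar c v u' = 1")
    case True
    obtain \<kappa> :: Kbar where lam: "\<kappa>\<^sup>2 + \<kappa> + to_ac (form_eval 3 c v) = 0" by (rule split_quadratic)
    define \<mu> where "\<mu> = \<kappa> + 1"
    have mu: "\<mu>\<^sup>2 + \<mu> + to_ac (form_eval 3 c v) = 0"
      using lam by (simp add: \<mu>_def power2_eq_square algebra_simps Kbar_add_self Kbar_add_self_left)
    have ne: "\<kappa> \<noteq> \<mu>" by (simp add: \<mu>_def)
    have line: "line_on c ?U (\<nu> *s ?U' + ?V)" if nu: "\<nu>\<^sup>2 + \<nu> + to_ac (form_eval 3 c v) = 0" for \<nu>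
      unfolding line_on_def
    proof
      show "indep2 ?U (\<nu> *s ?U' + ?V)"
        unfolding indep2_def
      proof (intro allI impI)
        fix s t assume "s *s ?U + t *s (\<nu> *s ?U' + ?V) = 0"
        then have "s *s ?U + (t * \<nu>) *s ?U' + t *s ?V = 0"
          by (simp add: vec_eq_iff algebra_simps)
        from ind[OF this] show "s = 0 \<and> t = 0" by simp
      qed
      have "cubic_bar c (s *s ?U + t *s (\<nu> *s ?U' + ?V)) = 0" for s t
      proof -
        have "s *s ?U + t *s (\<nu> *s ?U' + ?V) = s *s ?U + (t * \<nu>) *s ?U' + t *s ?V"
          by (simp add: vec_eq_iff algebra_simps)
        then have "cubic_bar c (s *s ?U + t *s (\<nu> *s ?U' + ?V)) =
          t * (t * t) * (\<nu>\<^sup>2 + \<nu> + to_ac (form_eval 3 c v))"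
          unfolding cubic_bar_def by (simp only: plane True) (simp add: power2_eq_square algebra_simps)
        then show ?thesis using nu by simp
      qed
      then show "\<forall>x\<in>lspan ?U (\<nu> *s ?U' + ?V). cubic_bar c x = 0"
        unfolding lspan_def by blast
    qed
    have line0: "line_on c ?U ?U'"
      unfolding line_on_def indep2_def
    proof (intro conjI allI impI ballI)
      fix s t assume "s *s ?U + t *s ?U' = 0"
      then have "s *s ?U + t *s ?U' + 0 *s ?V = 0" by simp
      from ind[OF this] show "s = 0" "t = 0" by simp_all
    next
      fix x assume "x \<in> lspan ?U ?U'"
      then show "cubic_bar c x = 0" unfolding lspan_def cubic_bar_def using l by (auto simp: bar_line)
    qed
    have in_span: "a \<in> lspan a b" "b \<in> lspan a b" for a b :: "Kbar^4"
    proof -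
      have "a = 1 *s a + 0 *s b" "b = 0 *s a + 1 *s b" by simp_all
      then show "a \<in> lspan a b" "b \<in> lspan a b" unfolding lspan_def by blast+
    qed
    have notin0: "\<nu> *s ?U' + ?V \<notin> lspan ?U ?U'" for \<nu>
    proof
      assume "\<nu> *s ?U' + ?V \<in> lspan ?U ?U'"
      then obtain s t where "\<nu> *s ?U' + ?V = s *s ?U + t *s ?U'" unfolding lspan_def by blast
      then have "s *s ?U + (t - \<nu>) *s ?U' + (-1) *s ?V = 0" by (auto simp: vec_eq_iff algebra_simps)
      from ind[OF this] show False by simp
    qed
    have notin: "\<kappa> *s ?U' + ?V \<notin> lspan ?U (\<mu> *s ?U' + ?V)"
    proof
      assume "\<kappa> *s ?U' + ?V \<in> lspan ?U (\<mu> *s ?U' + ?V)"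
      then obtain s t where "\<kappa> *s ?U' + ?V = s *s ?U + t *s (\<mu> *s ?U' + ?V)" unfolding lspan_def by blast
      then have "s *s ?U + (t * \<mu> - \<kappa>) *s ?U' + (t - 1) *s ?V = 0" by (auto simp: vec_eq_iff algebra_simps)
      from ind[OF this] show False using ne by auto
    qed
    have "lspan ?U ?U' \<noteq> lspan ?U (\<kappa> *s ?U' + ?V)" "lspan ?U ?U' \<noteq> lspan ?U (\<mu> *s ?U' + ?V)"
      "lspan ?U (\<kappa> *s ?U' + ?V) \<noteq> lspan ?U (\<mu> *s ?U' + ?V)"
      using notin notin0 in_span by metis+
    moreover have "?U \<noteq> 0" using ind[of 1 0 0] by auto
    moreover have "cubic_bar c ?U = 0" using l by (simp add: cubic_bar_def form_eval_vec_bar)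
    ultimately show ?thesis
      unfolding eckardt_def using line0 line[OF lam] line[OF mu] in_span(1) by blast
  next
    case False
    interpret binary_cubic_line "nonzero_at c" "transversal c" u u'
      using indep l by unfold_locales auto
    obtain w where w: "transversal c u' w" "\<not> nonzero_at c w" "\<not> transversal c u w"
      "\<not> transversal c w u" "\<not> transversal c w u'" "\<not> transversal c w w"
      "\<not> transversal c (w + u) u" "\<not> transversal c (w + u) u'" "\<not> transversal c (w + u) w"
      by (rule double_line[of v]) (use t False in auto)
    have "w \<notin> line"
      using D_line_mem[of w u'] line_facts w(1) by blast
    then have ind': "w \<noteq> 0" "u \<noteq> w" "u' \<notin> {0, u, w, u + w}"
      using indep(2,3) add_self_left[of u w] by auto
    have "polar c u y = 0 \<and> polar c w y = 0 \<and> polar c (u + w) y = 0" if "y \<in> {u, w, u'}" for y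
      using that w(2-) D_line(1) D_r_s unfolding bit_not_one_iff add.commute[of u w] by blast
    then have False using double_line_singular[OF c indep(1) ind' l(1)] w(2) by auto
    then show ?thesis ..
  qed
qed

theorem theorem3:
  fixes c :: "nat^4 \<Rightarrow> K" and a b :: "K^4"
  assumes "smooth_cubic c"
    and "indep2 a b"
    and "line_on c (vec_bar a) (vec_bar b)"
    and "\<forall>P\<in>lspan a b. P \<noteq> 0 \<longrightarrow> \<not> eckardt c (vec_bar P)"
  shows "\<exists>P\<in>lspan a b. P \<noteq> 0 \<and> Span c {P} = rat_points c"
proof -
  interpret binary_cubic "nonzero_at c" "transversal c" by (rule binary_cubic_form)
  have nz: "a \<noteq> 0" "b \<noteq> 0" "a \<noteq> b"
  proof -
    have "1 *s a + 0 *s b \<noteq> 0" "0 *s a + 1 *s b \<noteq> 0" "1 *s a + 1 *s b \<noteq> 0"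
      using assms(2) unfolding indep2_def by (metis zero_neq_one)+
    then show "a \<noteq> 0" "b \<noteq> 0" "a \<noteq> b" by (auto simp: bit_vec_add_self)
  qed
  note l = line_on_rational[OF assms(3)]
  interpret binary_cubic_line "nonzero_at c" "transversal c" a b
    using nz l by unfold_locales auto
  have "a = 1 *s a + 0 *s b" "b = 0 *s a + 1 *s b" "a + b = 1 *s a + 1 *s b" "0 = 0 *s a + 0 *s b"
    by simp_all
  then have line_lspan: "line \<subseteq> lspan a b" unfolding lspan_def by blast
  have line_add: "x + y \<in> line" if "x \<in> line" "y \<in> line" for x y
    using that by (elim insertE emptyE) (simp_all add: char2_simps)
  have line_card: "card line = 4" using nz third_point(1-3) by (auto simp: card_insert_if)
  then obtain d where d: "d \<notin> line"
  proof -
    obtain v where "transversal c a v" using smooth_cubic_rational[OF assms(1) nz(1)] l by auto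
    then show ?thesis using D_line_mem[of v a] D_add line_facts that by (metis D_0 insert_iff empty_iff)
  qed
  obtain e where e: "\<And>v. v \<in> line \<or> v + d \<in> line \<or> v + e \<in> line \<or> v + (d + e) \<in> line"
    using bit_coset_reps[OF line_add line_card d] by blast
  interpret eckardt_free_line "nonzero_at c" "transversal c" a b d e
  proof
    show "v \<in> line \<or> v + d \<in> line \<or> v + e \<in> line \<or> v + (d + e) \<in> line" for v by (rule e)
    show "\<exists>v. transversal c u v" if "\<not> nonzero_at c u" "u \<noteq> 0" for u
      using smooth_cubic_rational[OF assms(1) that(2,1)] by blast
    show "\<exists>v. transversal c a v \<noteq> transversal c b v \<or> transversal c b v \<noteq> transversal c (a + b) v"
      by (rule tangent_planes_not_const[OF assms(1,3)])
    fix u u' v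
    assume u: "u \<in> line" "u' \<in> line" "u \<noteq> 0" "u' \<noteq> 0" "u \<noteq> u'" and v: "v \<notin> line"
      and t: "\<not> transversal c u v" "transversal c u' v" "transversal c (u + u') v"
    \<comment> \<open>Any two distinct nonzero points generate the line, so \<open>v\<close> is
      independent of \<open>u\<close> and \<open>u'\<close>.\<close>
    have "{0, u, u', u + u'} = line"
    proof (rule card_subset_eq)
      show "{0, u, u', u + u'} \<subseteq> line" using u line_add by blast
      show "card {0, u, u', u + u'} = card line" unfolding line_card
        using u by (auto simp: card_insert_if add_eq_0_iff)
    qed simp
    then have v': "v \<notin> {0, u, u', u + u'}" using v by simp
    have F_line: "\<not> nonzero_at c x" if "x \<in> line" for x
      using that F_0 line_facts by auto
    have D_line: "\<not> transversal c x y" if "x \<in> line" "y \<in> line" for x y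
      using D_line_mem[OF that(2), of x] that(1) D_0_left line_facts by auto
    have "\<not> eckardt c (vec_bar u)" using assms(4) line_lspan u by blast
    then show "transversal c v u"
      using singular_conic_eckardt[OF assms(1) u(3-5) v'] F_line[OF u(1)] F_line[OF u(2)]
        D_line[OF u(1,2)] D_line[OF u(2,1)] t
      by (metis bit_not_one_iff)
  qed
  obtain P where P: "P \<in> {a, b, a + b}" "\<forall>v. \<not> nonzero_at c v \<longrightarrow> v \<noteq> 0 \<longrightarrow> spans P v"
    using line_point_spans by metis
  have P_nz: "P \<noteq> 0" and "P \<in> line" "\<not> nonzero_at c P" using P(1) nz third_point line_facts by auto
  then have PB: "{P} \<subseteq> rat_points c" by (simp add: rat_points_def)
  have "P \<in> Span c {P}" unfolding Span_def by (rule UN_I[of 0]) simp_all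
  \<comment> \<open>The set \<open>Span c {P}\<close> is itself stable and contains
    \<open>P\<close>, so it is an instance in the definition of \<open>spans\<close>.\<close>
  then have "v \<in> Span c {P}" if "v \<in> rat_points c" for v
    using P(2)[rule_format, of v] that Span_stable[OF PB] unfolding spans_def rat_points_def by auto
  then have "Span c {P} = rat_points c" using Span_subset[OF PB] by blast
  then show ?thesis using P_nz \<open>P \<in> line\<close> line_lspan by blast
qed

end
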